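(* Let $m\ge 2$ and let $H\le\mathrm{Sym}(m)$ be a transitive group. Then there exists $b\ge 2$ such that $$\mathrm{hspec}_{b}^{\mathcal S}(W_H)=\mathrm{hspec}_{\mathrm{fg}}^{\mathcal S}(W_H)=\mathrm{hspec}^{\mathcal S}(W_H)=[0,1].$$
   Context: $T_m$ is the infinite rooted tree in which every vertex has exactly $m$ immediate descendants, with vertices identified with finite words over $\{1,\dots,m\}$. $\mathrm{Aut}\,T_m$ is its group of root-fixing automorphisms, with the topology given by the level stabilizers $\mathrm{St}(n)$ (pointwise stabilizers of the set of words of length $n$). The label of $g\in\mathrm{Aut}\,T_m$ at a vertex $v$ is the permutation $g|_v^1\in\mathrm{Sym}(m)$ with $(vx)g=(v)g\,(x)g|_v^1$ for every letter $x$. For $H\le\mathrm{Sym}(m)$, the iterated permutational wreath product is $$W_H=\{g\in\mathrm{Aut}\,T_m\mid g|_v^1\in H\text{ for every vertex }v\}\cong\varprojlim H\wr\overset{n}{\cdots}\wr H .$$ For a closed subgroup $L\le W_H$, $$\mathrm{hdim}^{\mathcal S}_{W_H}(L)=\liminf_{n\to\infty}\frac{\log|L:L\cap\mathrm{St}(n)|}{\log|W_H:W_H\cap\mathrm{St}(n)|}.$$ $\mathrm{hspec}^{\mathcal S}(W_H)$, $\mathrm{hspec}^{\mathcal S}_{\mathrm{fg}}(W_H)$, $\mathrm{hspec}^{\mathcal S}_b(W_H)$ are the sets of values of $\mathrm{hdim}^{\mathcal S}_{W_H}(L)$ where $L$ ranges over all closed subgroups, all topologically finitely generated closed subgroups,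 and all closed subgroups topologically generated by at most $b$ elements, respectively. *)

theory Defs
  imports
    "HOL-Algebra.Sym_Groups"
    "HOL-Algebra.Generated_Groups"
    "HOL-Analysis.Analysis"
begin

definition tree_words :: "nat \<Rightarrow> nat list set"
  where "tree_words m = lists {1..m}"

definition tree_adj :: "nat list \<Rightarrow> nat list \<Rightarrow> bool"
  where "tree_adj v w \<longleftrightarrow> (\<exists>x. w = v @ [x] \<or> v = w @ [x])"

text \<open>
  Automorphisms are total functions on lists; as with \<^const>\<open>permutes\<close>, they are
  the identity outside the vertex set, so each automorphism has exactly one representative.
  The product is composition, as in \<^const>\<open>sym_group\<close>. For the opposite convention
  (right actions) subgroups, generated subgroups, indices of subgroups and the topology below
  are the same.
\<close>

definition tree_aut :: "nat \<Rightarrow> (nat list \<Rightarrow> nat list) monoid"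
  where "tree_aut m =
    \<lparr> carrier = {g. g permutes tree_words m \<and> g [] = [] \<and>
        (\<forall>v\<in>tree_words m. \<forall>w\<in>tree_words m. tree_adj (g v) (g w) \<longleftrightarrow> tree_adj v w)},
      mult = (\<circ>), one = id \<rparr>"

definition level_stab :: "nat \<Rightarrow> nat \<Rightarrow> (nat list \<Rightarrow> nat list) set"
  where "level_stab m n =
    {g \<in> carrier (tree_aut m). \<forall>w\<in>tree_words m. length w = n \<longrightarrow> g w = w}"

text \<open>The group topology in which the level stabilizers form a neighbourhood base of the identity.\<close>

definition tree_topology :: "nat \<Rightarrow> (nat list \<Rightarrow> nat list) topology"
  where "tree_topology m =
    topology_generated_by {g <#\<^bsub>tree_aut m\<^esub> level_stab m n | g n. g \<in> carrier (tree_aut m)}"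

text \<open>
  The label of \<open>g\<close> at \<open>v\<close>, extended by the identity outside \<open>{1..m}\<close>;
  the lemmas \<open>tree_aut_label\<close> and \<open>label_permutes\<close> below give its defining properties.
\<close>

definition tree_label :: "nat \<Rightarrow> (nat list \<Rightarrow> nat list) \<Rightarrow> nat list \<Rightarrow> nat \<Rightarrow> nat"
  where "tree_label m g v = (\<lambda>x. if x \<in> {1..m} then last (g (v @ [x])) else x)"

definition wreath :: "nat \<Rightarrow> (nat \<Rightarrow> nat) set \<Rightarrow> (nat list \<Rightarrow> nat list) monoid"
  where "wreath m H = (tree_aut m)
    \<lparr> carrier := {g \<in> carrier (tree_aut m). \<forall>v\<in>tree_words m. tree_label m g v \<in> H} \<rparr>"

definition wreath_topology :: "nat \<Rightarrow> (nat \<Rightarrow> nat) set \<Rightarrow> (nat list \<Rightarrow> nat list) topology"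
  where "wreath_topology m H = subtopology (tree_topology m) (carrier (wreath m H))"

definition closed_subgroup :: "nat \<Rightarrow> (nat \<Rightarrow> nat) set \<Rightarrow> (nat list \<Rightarrow> nat list) set \<Rightarrow> bool"
  where "closed_subgroup m H L \<longleftrightarrow>
    subgroup L (wreath m H) \<and> closedin (wreath_topology m H) L"

definition top_generates ::
    "nat \<Rightarrow> (nat \<Rightarrow> nat) set \<Rightarrow> (nat list \<Rightarrow> nat list) set \<Rightarrow> (nat list \<Rightarrow> nat list) set \<Rightarrow> bool"
  where "top_generates m H S L \<longleftrightarrow>
    S \<subseteq> L \<and> L = wreath_topology m H closure_of (generate (wreath m H) S)"

definition subgroup_index :: "('a, 'b) monoid_scheme \<Rightarrow> 'a set \<Rightarrow> 'a set \<Rightarrow> nat"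
  where "subgroup_index G L K = card (rcosets\<^bsub>G\<lparr>carrier := L\<rparr>\<^esub> K)"

text \<open>
  The quotient at \<open>n = 0\<close> is \<open>0 / 0 = 0\<close> and does not affect the lower limit.
\<close>

definition hdim :: "nat \<Rightarrow> (nat \<Rightarrow> nat) set \<Rightarrow> (nat list \<Rightarrow> nat list) set \<Rightarrow> ereal"
  where "hdim m H L = liminf (\<lambda>n. ereal (
    ln (real (subgroup_index (wreath m H) L (L \<inter> level_stab m n))) /
    ln (real (subgroup_index (wreath m H) (carrier (wreath m H))
      (carrier (wreath m H) \<inter> level_stab m n)))))"

definition hspec :: "nat \<Rightarrow> (nat \<Rightarrow> nat) set \<Rightarrow> ereal set"
  where "hspec m H = {hdim m H L | L. closed_subgroup m H L}"

definition hspec_fg :: "nat \<Rightarrow> (nat \<Rightarrow> nat) set \<Rightarrow> ereal set"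
  where "hspec_fg m H =
    {hdim m H L | L. closed_subgroup m H L \<and> (\<exists>S. finite S \<and> top_generates m H S L)}"

definition hspec_gen :: "nat \<Rightarrow> nat \<Rightarrow> (nat \<Rightarrow> nat) set \<Rightarrow> ereal set"
  where "hspec_gen b m H =
    {hdim m H L | L. closed_subgroup m H L \<and>
      (\<exists>S. finite S \<and> card S \<le> b \<and> top_generates m H S L)}"

lemma tree_words_snoc: "v @ [x] \<in> tree_words m \<longleftrightarrow> v \<in> tree_words m \<and> x \<in> {1..m}"
  by (auto simp: tree_words_def)

lemma tree_aut_child:
  assumes g: "g \<in> carrier (tree_aut m)" and "v @ [x] \<in> tree_words m"
  shows "\<exists>y\<in>{1..m}. g (v @ [x]) = g v @ [y]"
  using assms(2)
proof (induction v arbitrary: x rule: rev_induct)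
  have p: "g permutes tree_words m" and r: "g [] = []"
    using g by (auto simp: tree_aut_def)
  have adj: "tree_adj (g v) (g (v @ [x]))" if "v @ [x] \<in> tree_words m" for v x
    using g that by (auto simp: tree_aut_def tree_words_snoc tree_adj_def)
  have mem: "g w \<in> tree_words m" if "w \<in> tree_words m" for w
    using permutes_in_image[OF p] that by blast
  {
    case Nil
    then show ?case
      using adj[of "[]" x] mem[of "[x]"] r by (auto simp: tree_adj_def tree_words_def)
  next
    case (snoc a u)
    define v where "v = u @ [a]"
    have v: "v @ [x] \<in> tree_words m" "u @ [a] \<in> tree_words m"
      using snoc.prems by (auto simp: v_def tree_words_def)
    obtain b where b: "g v = g u @ [b]"
      using snoc.IH[OF v(2)] v_def by blast
    have ne: "g (v @ [x]) \<noteq> g u"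
      using permutes_inj[OF p] by (auto simp: inj_eq v_def)
    obtain y where y: "g (v @ [x]) = g v @ [y]"
      using adj[OF v(1)] ne b by (auto simp: tree_adj_def)
    then show ?case
      using mem[OF v(1)] by (auto simp: v_def tree_words_def)
  }
qed

lemma tree_aut_label:
  assumes "g \<in> carrier (tree_aut m)" "v \<in> tree_words m" "x \<in> {1..m}"
  shows "g (v @ [x]) = g v @ [tree_label m g v x]"
  using tree_aut_child[OF assms(1), of v x] assms(2,3)
  by (auto simp: tree_label_def tree_words_snoc)

lemma label_permutes:
  assumes "g \<in> carrier (tree_aut m)" "v \<in> tree_words m"
  shows "tree_label m g v permutes {1..m}"
proof (rule bij_imp_permutes)
  have p: "g permutes tree_words m"
    using assms by (auto simp: tree_aut_def)
  have "inj_on (tree_label m g v) {1..m}"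
  proof (rule inj_onI)
    fix x y assume xy: "x \<in> {1..m}" "y \<in> {1..m}" "tree_label m g v x = tree_label m g v y"
    then have "g (v @ [x]) = g (v @ [y])"
      using tree_aut_label[OF assms] by simp
    then show "x = y"
      using permutes_inj[OF p] by (simp add: inj_eq)
  qed
  moreover have "tree_label m g v ` {1..m} \<subseteq> {1..m}"
    using tree_aut_child[OF assms(1), of v] assms(2)
    by (fastforce simp: tree_label_def tree_words_snoc)
  ultimately show "bij_betw (tree_label m g v) {1..m} {1..m}"
    by (simp add: bij_betw_def endo_inj_surj)
qed (auto simp: tree_label_def)

lemma group_tree_aut: "group (tree_aut m)"
proof (rule groupI)
  fix g h assume gh: "g \<in> carrier (tree_aut m)" "h \<in> carrier (tree_aut m)"
  then have "h v \<in> tree_words m" if "v \<in> tree_words m" for v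
    using that by (auto simp: tree_aut_def permutes_in_image)
  then show "g \<otimes>\<^bsub>tree_aut m\<^esub> h \<in> carrier (tree_aut m)"
    using gh by (auto simp: tree_aut_def permutes_compose)
next
  fix g assume g: "g \<in> carrier (tree_aut m)"
  then have p: "g permutes tree_words m" by (simp add: tree_aut_def)
  have i: "Hilbert_Choice.inv g v \<in> tree_words m" "g (Hilbert_Choice.inv g v) = v"
    if "v \<in> tree_words m" for v
    using that permutes_in_image[OF permutes_inv[OF p]] permutes_inverses[OF p] by auto
  have "Hilbert_Choice.inv g [] = []"
    using g permutes_inverses(2)[OF p, of "[]"] by (simp add: tree_aut_def)
  moreover have "tree_adj (Hilbert_Choice.inv g v) (Hilbert_Choice.inv g w) \<longleftrightarrow> tree_adj v w"
    if "v \<in> tree_words m" "w \<in> tree_words m" for v w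
    using g i[OF that(1)] i[OF that(2)] by (auto simp: tree_aut_def) metis+
  ultimately have "Hilbert_Choice.inv g \<in> carrier (tree_aut m)"
    using permutes_inv[OF p] by (simp add: tree_aut_def)
  then show "\<exists>h\<in>carrier (tree_aut m). h \<otimes>\<^bsub>tree_aut m\<^esub> g = \<one>\<^bsub>tree_aut m\<^esub>"
    using permutes_inv_o(2)[OF p] by (auto simp: tree_aut_def)
qed (auto simp: tree_aut_def permutes_id comp_assoc)

lemma tree_label_mult:
  assumes gh: "g \<in> carrier (tree_aut m)" "h \<in> carrier (tree_aut m)" and v: "v \<in> tree_words m"
  shows "tree_label m (g \<otimes>\<^bsub>tree_aut m\<^esub> h) v = tree_label m g (h v) \<circ> tree_label m h v"
proof
  fix x
  have hv: "h v \<in> tree_words m"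
    using gh v by (auto simp: tree_aut_def permutes_in_image)
  show "tree_label m (g \<otimes>\<^bsub>tree_aut m\<^esub> h) v x = (tree_label m g (h v) \<circ> tree_label m h v) x"
  proof (cases "x \<in> {1..m}")
    case True
    then have y: "tree_label m h v x \<in> {1..m}"
      using permutes_in_image[OF label_permutes[OF gh(2) v]] by blast
    have "(g \<otimes>\<^bsub>tree_aut m\<^esub> h) (v @ [x]) = g (h v) @ [tree_label m g (h v) (tree_label m h v x)]"
      using tree_aut_label[OF gh(2) v True] tree_aut_label[OF gh(1) hv y] by (simp add: tree_aut_def)
    then show ?thesis
      using True by (simp add: tree_label_def)
  qed (auto simp: tree_label_def)
qed

lemma subgroup_wreath:
  assumes H: "subgroup H (sym_group m)"
  shows "subgroup (carrier (wreath m H)) (tree_aut m)"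
proof -
  interpret T: group "tree_aut m" by (rule group_tree_aut)
  have mem: "h v \<in> tree_words m" if "h \<in> carrier (tree_aut m)" "v \<in> tree_words m" for h v
    using that by (auto simp: tree_aut_def permutes_in_image)
  have one: "tree_label m \<one>\<^bsub>tree_aut m\<^esub> v = id" for v
    by (auto simp: tree_label_def tree_aut_def)
  show ?thesis
  proof (rule T.subgroupI)
    have "\<one>\<^bsub>tree_aut m\<^esub> \<in> carrier (wreath m H)"
      using subgroup.one_closed[OF H] one by (simp add: wreath_def sym_group_def)
    then show "carrier (wreath m H) \<noteq> {}" by blast
  next
    fix g assume g: "g \<in> carrier (wreath m H)"
    then have g': "g \<in> carrier (tree_aut m)" by (simp add: wreath_def)
    let ?i = "inv\<^bsub>tree_aut m\<^esub> g"
    have i: "?i \<in> carrier (tree_aut m)" using g' by simp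
    have "tree_label m ?i v \<in> H" if v: "v \<in> tree_words m" for v
    proof -
      let ?a = "tree_label m g (?i v)"
      have a: "?a \<in> H" using g mem[OF i v] by (simp add: wreath_def)
      then have ac: "?a \<in> carrier (sym_group m)"
        using subgroup.mem_carrier[OF H] by blast
      have "?a \<circ> tree_label m ?i v = id"
        using tree_label_mult[OF g' i v] one T.r_inv[OF g'] by simp
      then have "inv\<^bsub>sym_group m\<^esub> ?a = tree_label m ?i v"
        using group.inv_solve_left[OF sym_group_is_group]
          label_permutes[OF i v] ac group.inv_equality[OF sym_group_is_group]
          group.inv_comm[OF sym_group_is_group]
        by (metis sym_group_carrier sym_group_mult sym_group_one)
      then show ?thesis
        using subgroup.m_inv_closed[OF H a] by simp
    qed
    then show "?i \<in> carrier (wreath m H)"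
      using i by (simp add: wreath_def)
  next
    fix g h assume "g \<in> carrier (wreath m H)" "h \<in> carrier (wreath m H)"
    then show "g \<otimes>\<^bsub>tree_aut m\<^esub> h \<in> carrier (wreath m H)"
      using tree_label_mult[of g m h] subgroup.m_closed[OF H] mem[of h]
      by (auto simp: wreath_def sym_group_mult)
  qed (simp add: wreath_def)
qed

end

theory Submission
  imports Defs "HOL-Library.Sublist"
begin

text \<open>
  Every value of the dimension lies in \<open>[0,1]\<close>, so the point is to find, for each \<open>\<alpha> \<in> [0,1]\<close>,
  a closed subgroup of dimension \<open>\<alpha>\<close> whose number of topological generators does not depend
  on \<open>\<alpha>\<close>; \<open>4 * card H\<close> generators turn out to be enough.

  A base \<open>m\<close> expansion of \<open>\<alpha>\<close> gives a prefix-free set \<open>C\<close> of words whose cylinders have total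
  measure \<open>\<alpha>\<close> (\<open>digit_expansion\<close>, \<open>sum_digit_words\<close>). The automorphisms that act only below
  the words in \<open>C\<close> form a product of copies of the full wreath product, one for each \<open>c \<in> C\<close>, of
  dimension \<open>\<alpha>\<close>. This product need not be finitely generated, but the dimension only sees the
  proportion of the labels on level \<open>n\<close> that can be prescribed independently by elements of the
  \<open>n\<close>-th level stabilizer (\<open>layer_growth\<close>). So it suffices to find finitely many elements of the
  product for which this proportion, below each single \<open>c\<close>, tends to 1 with the level. Uniformity
  in \<open>c\<close> is not required, because the finitely many short words carry almost all of the measure
  (\<open>truncated_sum_tendsto\<close>).

  All generators have the form \<open>mark P h\<close>: the label is \<open>h\<close> at the vertices of a prefix-free set
  \<open>P\<close> and trivial elsewhere. Three families of them perform the same automorphism below every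
  \<open>c \<in> C\<close>, with the label \<open>h\<close> at the root, at the vertices \<open>1\<^sup>j2\<close> for even \<open>j\<close>, or at those for odd
  \<open>j\<close>. They generate a group that is transitive on every level (\<open>spinal_transitive\<close>). In the last
  family, \<open>P\<close> consists of one vertex \<open>c @ pivot c N\<close> for each \<open>c \<in> C\<close> and each large level \<open>N\<close>;
  a single element thus encodes a label for infinitely many pairs \<open>(c, N)\<close>.

  Commutators decode it. Each pivot lies below an address \<open>u\<close>, and two different addresses first
  differ at an even position. On the other hand, a conjugate \<open>t\<close> of an odd mark by an element that
  carries \<open>1\<^sup>k\<close> to \<open>u\<close> fixes all words that first differ from \<open>u\<close> at an even position
  (\<open>side_group_fixes_forks\<close>). Hence \<open>t\<close>, performed below every \<open>c\<close>, commutes with all of the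
  element \<open>x = mark pivots h\<close> except its label at the one pivot \<open>p\<close> below \<open>u\<close>, and the commutator
  of \<open>x\<close> and \<open>t\<close> lies in a level stabilizer and has labels only at \<open>p\<close> and \<open>t p\<close> on that level
  (\<open>linked_pivot\<close>). Vertices that are linked by such elements form classes, and all labels except
  one in each class can be prescribed (\<open>linked_representatives\<close>). The class of \<open>p\<close> contains the
  orbit of \<open>p\<close> under the group generated by the elements \<open>t\<close>, which has at least \<open>m\<^sup>e\<close> elements,
  where \<open>e\<close> is about half of the distance from the address to the pivot (\<open>side_group_orbit\<close>).
  Addresses are chosen so short that this distance tends to infinity with \<open>N\<close> for fixed \<open>c\<close>, so
  that the proportion of lost labels tends to 0.
\<close>

section \<open>Words and elements of the wreath product\<close>

definition level :: "nat \<Rightarrow> nat \<Rightarrow> nat list set"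
  where "level m n = {w \<in> tree_words m. length w = n}"

lemma tree_words_append: "v @ w \<in> tree_words m \<longleftrightarrow> v \<in> tree_words m \<and> w \<in> tree_words m"
  by (auto simp: tree_words_def)

lemma tree_words_Nil [simp]: "[] \<in> tree_words m"
  by (simp add: tree_words_def)

lemma level_eq: "level m n = {w. set w \<subseteq> {1..m} \<and> length w = n}"
  by (auto simp: level_def tree_words_def)

lemma finite_level [simp]: "finite (level m n)"
  unfolding level_eq by (rule finite_lists_length_eq) simp

lemma card_level: "card (level m n) = m ^ n"
  unfolding level_eq by (subst card_lists_length_eq) auto

lemma level_Suc: "v @ [x] \<in> level m (Suc n) \<longleftrightarrow> v \<in> level m n \<and> x \<in> {1..m}"
  by (auto simp: level_def tree_words_snoc)

lemma level_SucE:
  assumes "w \<in> level m (Suc n)"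
  obtains v x where "w = v @ [x]" "v \<in> level m n" "x \<in> {1..m}"
  using assms by (cases w rule: rev_cases) (auto simp: level_def tree_words_snoc)

locale wreath_product =
  fixes m :: nat and H :: "(nat \<Rightarrow> nat) set"
  assumes m2: "m \<ge> 2" and H: "subgroup H (sym_group m)"
begin

abbreviation "W \<equiv> carrier (wreath m H)"
abbreviation "label \<equiv> tree_label m"
abbreviation "wreath_closure \<equiv> (closure_of) (wreath_topology m H)"

lemma H_permutes: "h \<in> H \<Longrightarrow> h permutes {1..m}"
  using subgroup.mem_carrier[OF H] by (simp add: sym_group_def)

lemma H_id [simp]: "id \<in> H"
  using subgroup.one_closed[OF H] by (simp add: sym_group_def)

lemma H_comp [simp]: "h \<in> H \<Longrightarrow> k \<in> H \<Longrightarrow> h \<circ> k \<in> H"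
  using subgroup.m_closed[OF H, of h k] by (simp add: sym_group_def)

lemma H_inv [simp]: "h \<in> H \<Longrightarrow> Hilbert_Choice.inv h \<in> H"
  using subgroup.m_inv_closed[OF H, of h] sym_group_inv_equality[of h m] subgroup.mem_carrier[OF H]
  by metis

lemma finite_H: "finite H"
  by (rule finite_subset[OF _ finite_permutations[of "{1..m}"]]) (auto dest: H_permutes)

lemma W_D:
  assumes "g \<in> W"
  shows "g permutes tree_words m" "g [] = []" "g \<in> carrier (tree_aut m)"
    "v \<in> tree_words m \<Longrightarrow> label g v \<in> H"
  using assms by (auto simp: wreath_def tree_aut_def)

lemma W_snoc: "g \<in> W \<Longrightarrow> v @ [x] \<in> tree_words m \<Longrightarrow> g (v @ [x]) = g v @ [label g v x]"
  using tree_aut_label[of g m v x] W_D(3) by (auto simp: tree_words_snoc)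

lemma W_words [simp]: "g \<in> W \<Longrightarrow> g v \<in> tree_words m \<longleftrightarrow> v \<in> tree_words m"
  using permutes_in_image W_D(1) by metis

lemma W_child:
  assumes "g \<in> W" "v @ [x] \<in> tree_words m"
  obtains y where "y \<in> {1..m}" "g (v @ [x]) = g v @ [y]"
  using W_snoc[OF assms] W_words[OF assms(1), of "v @ [x]"] assms(2)
  by (simp only: tree_words_snoc) blast

lemma W_outside: "g \<in> W \<Longrightarrow> v \<notin> tree_words m \<Longrightarrow> g v = v"
  using permutes_not_in W_D(1) by metis

lemma W_eq_iff [simp]: "g \<in> W \<Longrightarrow> g v = g w \<longleftrightarrow> v = w"
  using permutes_inj W_D(1) by (metis inj_eq)

lemma W_length [simp]: "g \<in> W \<Longrightarrow> length (g w) = length w"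
proof (cases "w \<in> tree_words m")
  case True
  then show "g \<in> W \<Longrightarrow> length (g w) = length w"
    by (induction w rule: rev_induct) (auto simp: W_D(2) W_snoc tree_words_snoc)
qed (simp add: W_outside)

lemma W_level [simp]: "g \<in> W \<Longrightarrow> g w \<in> level m n \<longleftrightarrow> w \<in> level m n"
  by (simp add: level_def)

lemma W_take: "g \<in> W \<Longrightarrow> w \<in> tree_words m \<Longrightarrow> g (take n w) = take n (g w)"
proof (induction w rule: rev_induct)
  case (snoc x w)
  then show ?case
    by (cases "n \<le> length w") (auto simp: W_snoc tree_words_snoc)
qed (simp add: W_D)

text \<open>
  An automorphism is given by its portrait: membership in the wreath product and the values of
  the labels can be read off any family of elements of \<open>H\<close> that describes the action on children.
\<close>

lemma portrait:
  assumes "g permutes tree_words m" "g [] = []"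
    and lam: "\<And>v. v \<in> tree_words m \<Longrightarrow> lam v \<in> H"
    and snoc: "\<And>v x. v @ [x] \<in> tree_words m \<Longrightarrow> g (v @ [x]) = g v @ [lam v x]"
  shows "g \<in> W" and "v \<in> tree_words m \<Longrightarrow> label g v = lam v"
proof -
  have len: "length (g w) = length w" if "w \<in> tree_words m" for w
    using that by (induction w rule: rev_induct) (auto simp: assms tree_words_snoc)
  have inj: "g v = g w \<longleftrightarrow> v = w" for v w
    using permutes_inj[OF assms(1)] by (simp add: inj_eq)
  have *: "(\<exists>x. g w = g v @ [x]) \<longleftrightarrow> (\<exists>x. w = v @ [x])"
    if "v \<in> tree_words m" "w \<in> tree_words m" for v w
  proof
    assume "\<exists>x. w = v @ [x]" then show "\<exists>x. g w = g v @ [x]"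
      using snoc that by blast
  next
    assume "\<exists>x. g w = g v @ [x]"
    then obtain x where x: "g w = g v @ [x]" ..
    then have "length w = Suc (length v)" using len that by (metis length_append_singleton)
    then obtain w' y where w: "w = w' @ [y]" by (cases w rule: rev_cases) auto
    then have "g w' = g v" using x snoc that by force
    then show "\<exists>x. w = v @ [x]" using w inj by blast
  qed
  have lab: "label g v = lam v" if "v \<in> tree_words m" for v
  proof
    fix x show "label g v x = lam v x"
      using snoc[of v x] that permutes_not_in[OF H_permutes[OF lam[OF that]], of x]
      by (auto simp: tree_label_def tree_words_snoc)
  qed
  then show "v \<in> tree_words m \<Longrightarrow> label g v = lam v" .
  have "tree_adj (g v) (g w) \<longleftrightarrow> tree_adj v w"
    if "v \<in> tree_words m" "w \<in> tree_words m" for v w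
    using *[OF that] *[OF that(2) that(1)] by (auto simp: tree_adj_def)
  then show "g \<in> W"
    using assms(1,2) lam lab by (auto simp: wreath_def tree_aut_def)
qed

lemma group_wreath: "group (wreath m H)"
  using subgroup.subgroup_is_group[OF subgroup_wreath[OF H] group_tree_aut]
  by (simp add: wreath_def)

lemma wreath_mult [simp]: "x \<otimes>\<^bsub>wreath m H\<^esub> y = x \<circ> y"
  by (simp add: wreath_def tree_aut_def)

lemma wreath_one [simp]: "\<one>\<^bsub>wreath m H\<^esub> = id"
  by (simp add: wreath_def tree_aut_def)

lemma W_id [simp]: "id \<in> W"
  using group_wreath monoid.one_closed[of "wreath m H"] by (simp add: group_def)

lemma W_comp [simp]: "g \<in> W \<Longrightarrow> h \<in> W \<Longrightarrow> g \<circ> h \<in> W"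
  using group_wreath monoid.m_closed[of "wreath m H" g h] by (simp add: group_def)

lemma wreath_inv:
  assumes "g \<in> W"
  shows "inv\<^bsub>wreath m H\<^esub> g = Hilbert_Choice.inv g"
proof -
  have "inv\<^bsub>wreath m H\<^esub> g \<circ> g = id"
    using group.l_inv[OF group_wreath assms] by simp
  then show ?thesis
    using permutes_inv_o(1)[OF W_D(1)[OF assms]] by (metis comp_assoc comp_id id_comp)
qed

lemma W_inv [simp]: "g \<in> W \<Longrightarrow> Hilbert_Choice.inv g \<in> W"
  using group.inv_closed[OF group_wreath] wreath_inv by metis

lemma W_inverse [simp]:
  assumes "g \<in> W"
  shows "g (Hilbert_Choice.inv g v) = v" "Hilbert_Choice.inv g (g v) = v"
    "g \<circ> Hilbert_Choice.inv g = id" "Hilbert_Choice.inv g \<circ> g = id"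
  using permutes_inverses[OF W_D(1)[OF assms]] permutes_inv_o[OF W_D(1)[OF assms]] by auto

lemma label_comp:
  "g \<in> W \<Longrightarrow> h \<in> W \<Longrightarrow> v \<in> tree_words m \<Longrightarrow> label (g \<circ> h) v = label g (h v) \<circ> label h v"
  using tree_label_mult[of g m h v] W_D(3) by (simp add: tree_aut_def)

lemma label_id [simp]: "label id v = id"
  by (auto simp: tree_label_def)

lemma label_inv:
  assumes "g \<in> W" "v \<in> tree_words m"
  shows "label (Hilbert_Choice.inv g) (g v) = Hilbert_Choice.inv (label g v)"
proof -
  have "label (Hilbert_Choice.inv g) (g v) \<circ> label g v = id"
    using label_comp[of "Hilbert_Choice.inv g" g v] assms by simp
  then show ?thesis
    using permutes_inv_o(1)[OF H_permutes[OF W_D(4)[OF assms]]]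
    by (metis comp_assoc comp_id id_comp)
qed

lemma subgroup_W_D:
  assumes "subgroup G (wreath m H)"
  shows "G \<subseteq> W" "id \<in> G" "g \<in> G \<Longrightarrow> k \<in> G \<Longrightarrow> g \<circ> k \<in> G"
    "g \<in> G \<Longrightarrow> Hilbert_Choice.inv g \<in> G" "g \<in> G \<Longrightarrow> g \<in> W"
proof -
  show 1: "G \<subseteq> W" using subgroup.subset[OF assms] .
  show "id \<in> G" using subgroup.one_closed[OF assms] by simp
  show "g \<circ> k \<in> G" if "g \<in> G" "k \<in> G" using subgroup.m_closed[OF assms that] by simp
  show "g \<in> W" if "g \<in> G" using 1 that by blast
  then show "Hilbert_Choice.inv g \<in> G" if "g \<in> G"
    using subgroup.m_inv_closed[OF assms that] wreath_inv that by simp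
qed

lemma subgroup_WI:
  assumes "G \<subseteq> W" "id \<in> G" "\<And>g k. g \<in> G \<Longrightarrow> k \<in> G \<Longrightarrow> g \<circ> k \<in> G"
    "\<And>g. g \<in> G \<Longrightarrow> Hilbert_Choice.inv g \<in> G"
  shows "subgroup G (wreath m H)"
  using assms by (intro subgroup.intro) (auto simp: wreath_inv subset_iff)

section \<open>Level stabilizers, indices and closures\<close>

lemma level_stab_iff:
  assumes "g \<in> W"
  shows "g \<in> level_stab m n \<longleftrightarrow> (\<forall>w\<in>level m n. g w = w)"
  using W_D(3)[OF assms] by (auto simp: level_stab_def level_def)

text \<open>
  Every word is a prefix of a word on each deeper level, and automorphisms preserve prefixes.
\<close>

lemma agree_below:
  assumes "g \<in> W" "k \<in> W" "\<forall>w\<in>level m n. g w = k w" "w \<in> tree_words m" "length w \<le> n"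
  shows "g w = k w"
proof -
  define w' where "w' = w @ replicate (n - length w) 1"
  have w': "w' \<in> level m n"
    using assms(4,5) m2 by (auto simp: w'_def level_def tree_words_def)
  have "w = take (length w) w'" by (simp add: w'_def)
  then show ?thesis
    using W_take[OF assms(1), of w' "length w"] W_take[OF assms(2), of w' "length w"] assms(3) w'
    by (simp add: level_def)
qed

text \<open>
  Two elements lie in the same coset of the \<open>n\<close>-th level stabilizer exactly when they act in the
  same way on level \<open>n\<close>, so the index counts the different actions.
\<close>

lemma index_eq_card_actions:
  assumes L: "subgroup L (wreath m H)"
  shows "subgroup_index (wreath m H) L (L \<inter> level_stab m n) = card ((\<lambda>g. restrict g (level m n)) ` L)"
proof -
  note LD = subgroup_W_D[OF L]
  let ?act = "\<lambda>g. restrict g (level m n)"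
  let ?K = "L \<inter> level_stab m n"
  have same: "?act g = ?act k \<longleftrightarrow> (\<forall>w\<in>level m n. g w = k w)" for g k
    by (auto simp: restrict_def fun_eq_iff)
  define cos where "cos A = {k \<in> L. ?act k = A}" for A
  have coset: "?K #>\<^bsub>(wreath m H)\<lparr>carrier := L\<rparr>\<^esub> g = cos (?act g)" if g: "g \<in> L" for g
  proof -
    have "k \<in> ?K #>\<^bsub>(wreath m H)\<lparr>carrier := L\<rparr>\<^esub> g"
      if k: "k \<in> L" "\<forall>w\<in>level m n. k w = g w" for k
    proof -
      have "k \<circ> Hilbert_Choice.inv g \<in> ?K"
        using k g LD(3-5) level_stab_iff[of "k \<circ> Hilbert_Choice.inv g" n]
        by (auto simp: level_def)
      moreover have "k = (k \<circ> Hilbert_Choice.inv g) \<circ> g"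
        using LD(5)[OF g] by (simp add: comp_assoc)
      ultimately show ?thesis by (auto simp: r_coset_def)
    qed
    moreover have "k \<circ> g \<in> L \<and> (\<forall>w\<in>level m n. (k \<circ> g) w = g w)" if k: "k \<in> ?K" for k
      using k g LD(3,5) level_stab_iff[of k n] by auto
    ultimately show ?thesis
      by (auto simp: cos_def same r_coset_def)
  qed
  have "rcosets\<^bsub>(wreath m H)\<lparr>carrier := L\<rparr>\<^esub> ?K = cos ` ?act ` L"
    using coset by (auto simp: RCOSETS_def)
  moreover have "inj_on cos (?act ` L)"
    by (rule inj_onI) (auto simp: cos_def)
  ultimately show ?thesis
    by (simp add: subgroup_index_def card_image)
qed

text \<open>The cosets of the level stabilizers form a base, and not only a subbase, of the topology.\<close>

lemma open_contains_coset:
  assumes "openin (tree_topology m) U" "g \<in> U" "g \<in> W"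
  shows "\<exists>n. \<forall>k\<in>W. (\<forall>w\<in>level m n. k w = g w) \<longrightarrow> k \<in> U"
proof -
  have "generate_topology_on {g <#\<^bsub>tree_aut m\<^esub> level_stab m n | g n. g \<in> carrier (tree_aut m)} U"
    using assms(1) by (simp add: tree_topology_def openin_topology_generated_by_iff)
  then show ?thesis using assms(2)
  proof (induction rule: generate_topology_on.induct)
    case (Int a b)
    then obtain n1 n2 where
      n1: "\<forall>k\<in>W. (\<forall>w\<in>level m n1. k w = g w) \<longrightarrow> k \<in> a" and
      n2: "\<forall>k\<in>W. (\<forall>w\<in>level m n2. k w = g w) \<longrightarrow> k \<in> b" by auto
    have "k \<in> a \<inter> b" if "k \<in> W" "\<forall>w\<in>level m (max n1 n2). k w = g w" for k
      using n1 n2 that agree_below[OF that(1) assms(3) that(2)] by (auto simp: level_def)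
    then show ?case by blast
  next
    case (UN K)
    then obtain V where V: "V \<in> K" "g \<in> V" by blast
    then obtain n where "\<forall>k\<in>W. (\<forall>w\<in>level m n. k w = g w) \<longrightarrow> k \<in> V"
      using UN.IH by blast
    then show ?case using V(1) by blast
  next
    case (Basis s)
    then obtain a n where s: "s = a <#\<^bsub>tree_aut m\<^esub> level_stab m n" and a: "a \<in> carrier (tree_aut m)"
      by auto
    interpret T: group "tree_aut m" by (rule group_tree_aut)
    have tm [simp]: "x \<otimes>\<^bsub>tree_aut m\<^esub> y = x \<circ> y" "\<one>\<^bsub>tree_aut m\<^esub> = id" for x y
      by (auto simp: tree_aut_def)
    obtain c where c: "c \<in> level_stab m n" "g = a \<circ> c"
      using Basis s by (auto simp: l_coset_def)
    have "k \<in> s" if k: "k \<in> W" "\<forall>w\<in>level m n. k w = g w" for k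
    proof -
      let ?d = "inv\<^bsub>tree_aut m\<^esub> a \<circ> k"
      have d: "?d \<in> carrier (tree_aut m)"
        using T.m_closed[OF T.inv_closed[OF a] W_D(3)[OF k(1)]] by simp
      have e: "inv\<^bsub>tree_aut m\<^esub> a \<circ> a = id" "a \<circ> inv\<^bsub>tree_aut m\<^esub> a = id"
        using T.l_inv[OF a] T.r_inv[OF a] by auto
      have "?d w = w" if w: "w \<in> level m n" for w
      proof -
        have "?d w = (inv\<^bsub>tree_aut m\<^esub> a) (a (c w))" using k(2) w c(2) by auto
        also have "\<dots> = c w" using e(1) by (metis comp_apply id_apply)
        also have "\<dots> = w" using c(1) w by (auto simp: level_stab_def level_def)
        finally show ?thesis .
      qed
      then have "?d \<in> level_stab m n"
        using d by (auto simp: level_stab_def level_def)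
      moreover have "k = a \<circ> ?d" using e(2) by (metis comp_assoc id_comp)
      ultimately show ?thesis unfolding s l_coset_def by auto
    qed
    then show ?case by blast
  qed auto
qed

lemma coset_open: "g \<in> W \<Longrightarrow> openin (tree_topology m) (g <#\<^bsub>tree_aut m\<^esub> level_stab m n)"
  unfolding tree_topology_def using W_D(3)
  by (intro topology_generated_by_Basis) blast

lemma in_own_coset: "g \<in> g <#\<^bsub>tree_aut m\<^esub> level_stab m n"
proof -
  have "id \<in> level_stab m n"
    using W_D(3)[OF W_id] by (simp add: level_stab_def)
  then show ?thesis by (auto simp: l_coset_def tree_aut_def intro!: bexI[of _ id])
qed

lemma topspace_wreath_topology: "topspace (wreath_topology m H) = W"
proof -
  have "g \<in> topspace (tree_topology m)" if "g \<in> W" for g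
  proof -
    have "g \<in> g <#\<^bsub>tree_aut m\<^esub> level_stab m 0"
      by (rule in_own_coset)
    then show ?thesis using coset_open[OF that] openin_subset by blast
  qed
  then show ?thesis by (auto simp: wreath_topology_def)
qed

text \<open>
  Closure in the wreath product is approximation on each level, which makes the closure of a
  subgroup have the same actions on the levels as the subgroup itself.
\<close>

lemma closure_iff:
  assumes G: "G \<subseteq> W"
  shows "g \<in> wreath_closure G \<longleftrightarrow>
    g \<in> W \<and> (\<forall>n. \<exists>k\<in>G. \<forall>w\<in>level m n. k w = g w)"
proof (intro iffI conjI allI)
  assume g: "g \<in> wreath_closure G"
  then show gW: "g \<in> W"
    by (metis in_closure_of topspace_wreath_topology)
  fix n
  let ?U = "g <#\<^bsub>tree_aut m\<^esub> level_stab m n"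
  have "openin (wreath_topology m H) (?U \<inter> W)"
    unfolding wreath_topology_def using coset_open[OF gW] by (auto simp: openin_subtopology)
  moreover have "g \<in> ?U \<inter> W"
    using in_own_coset gW by blast
  ultimately obtain k where "k \<in> G" "k \<in> ?U"
    using g unfolding in_closure_of by blast
  then show "\<exists>k\<in>G. \<forall>w\<in>level m n. k w = g w"
    by (intro bexI[of _ k]) (auto simp: l_coset_def level_stab_def level_def tree_aut_def)
next
  assume g: "g \<in> W \<and> (\<forall>n. \<exists>k\<in>G. \<forall>w\<in>level m n. k w = g w)"
  show "g \<in> wreath_closure G"
    unfolding in_closure_of topspace_wreath_topology
  proof (intro conjI allI impI)
    fix T assume "g \<in> T \<and> openin (wreath_topology m H) T"
    then obtain U where U: "T = U \<inter> W" "openin (tree_topology m) U" "g \<in> U"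
      by (auto simp: wreath_topology_def openin_subtopology)
    obtain n where n: "\<forall>k\<in>W. (\<forall>w\<in>level m n. k w = g w) \<longrightarrow> k \<in> U"
      using open_contains_coset[OF U(2,3)] g by blast
    then show "\<exists>y. y \<in> G \<and> y \<in> T" using g G U(1) by blast
  qed (use g in simp)
qed

lemma closed_subgroup_closure:
  assumes G: "subgroup G (wreath m H)"
  shows "closed_subgroup m H (wreath_closure G)"
proof -
  note GD = subgroup_W_D[OF G]
  note cl = closure_iff[OF GD(1)]
  have "subgroup (wreath_closure G) (wreath m H)"
  proof (rule subgroup_WI)
    fix a b assume ab: "a \<in> wreath_closure G" "b \<in> wreath_closure G"
    then have W: "a \<in> W" "b \<in> W" by (auto simp: cl)
    show "a \<circ> b \<in> wreath_closure G"
      unfolding cl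
    proof (intro conjI allI)
      fix n
      obtain k where k: "k \<in> G" "\<forall>w\<in>level m n. k w = a w"
        using ab(1) unfolding cl by blast
      obtain l where l: "l \<in> G" "\<forall>w\<in>level m n. l w = b w"
        using ab(2) unfolding cl by blast
      show "\<exists>k\<in>G. \<forall>w\<in>level m n. k w = (a \<circ> b) w"
        using GD(3) W k l by (intro bexI[of _ "k \<circ> l"]) auto
    qed (use W in simp)
    show "Hilbert_Choice.inv a \<in> wreath_closure G"
      unfolding cl
    proof (intro conjI allI)
      fix n
      obtain k where k: "k \<in> G" "\<forall>w\<in>level m n. k w = a w"
        using ab(1) unfolding cl by blast
      have "Hilbert_Choice.inv k w = Hilbert_Choice.inv a w" if "w \<in> level m n" for w
      proof -
        let ?v = "Hilbert_Choice.inv a w"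
        have "k ?v = w" using k W that by simp
        then show ?thesis using GD(5)[OF k(1)] W_inverse(2) by metis
      qed
      then show "\<exists>k\<in>G. \<forall>w\<in>level m n. k w = Hilbert_Choice.inv a w"
        using GD(4)[OF k(1)] by blast
    qed (use W in simp)
  qed (use cl GD(2) in \<open>auto intro!: bexI[of _ id]\<close>)
  then show ?thesis by (simp add: closed_subgroup_def)
qed

lemma closure_actions:
  assumes "G \<subseteq> W"
  shows "(\<lambda>g. restrict g (level m n)) ` (wreath_closure G) =
    (\<lambda>g. restrict g (level m n)) ` G" (is "?a ` ?c = ?a ` G")
proof
  have "G \<subseteq> ?c" using assms topspace_wreath_topology closure_of_subset by metis
  then show "?a ` G \<subseteq> ?a ` ?c" by blast
  have "\<exists>k\<in>G. ?a g = ?a k" if "g \<in> ?c" for g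
    using that closure_iff[OF assms] by (metis restrict_ext)
  then show "?a ` ?c \<subseteq> ?a ` G" by blast
qed

end

section \<open>Grafting automorphisms along prefix-free sets\<close>

definition prefix_free :: "nat list set \<Rightarrow> bool"
  where "prefix_free P \<longleftrightarrow> (\<forall>p\<in>P. \<forall>q\<in>P. prefix p q \<longrightarrow> p = q)"

definition graft :: "nat list set \<Rightarrow> (nat list \<Rightarrow> nat list) \<Rightarrow> nat list \<Rightarrow> nat list"
  where "graft P f w =
    (if \<exists>p\<in>P. prefix p w
     then let p = THE p. p \<in> P \<and> prefix p w in p @ f (drop (length p) w) else w)"

definition root_perm :: "nat \<Rightarrow> (nat \<Rightarrow> nat) \<Rightarrow> nat list \<Rightarrow> nat list"
  where "root_perm m h w = (if w \<in> tree_words m \<and> w \<noteq> [] then h (hd w) # tl w else w)"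

lemma nth_prefix: "prefix p w \<Longrightarrow> i < length p \<Longrightarrow> w ! i = p ! i"
  by (elim prefixE) (simp add: nth_append)

lemma prefix_free_unique:
  assumes "prefix_free P" "p \<in> P" "q \<in> P" "prefix p w" "prefix q w"
  shows "p = q"
  using assms prefix_same_cases[OF assms(4,5)] unfolding prefix_free_def by blast

lemma prefix_free_subset: "prefix_free P \<Longrightarrow> Q \<subseteq> P \<Longrightarrow> prefix_free Q"
  unfolding prefix_free_def by blast

lemma prefix_free_singleton [simp]: "prefix_free {p}"
  by (simp add: prefix_free_def)

lemma graft_below:
  assumes "prefix_free P" "p \<in> P"
  shows "graft P f (p @ w) = p @ f w"
proof -
  have "(THE q. q \<in> P \<and> prefix q (p @ w)) = p"
    using assms prefix_free_unique[OF assms(1) _ assms(2), of _ "p @ w"] by (intro the_equality) auto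
  then show ?thesis
    using assms(2) by (auto simp: graft_def Let_def)
qed

lemma graft_outside: "\<not> (\<exists>p\<in>P. prefix p w) \<Longrightarrow> graft P f w = w"
  unfolding graft_def by argo

lemma graft_cases:
  obtains p v where "p \<in> P" "w = p @ v" | "\<not> (\<exists>p\<in>P. prefix p w)"
  by (auto simp: prefix_def)

lemma graft_comp:
  assumes "prefix_free P"
  shows "graft P f \<circ> graft P g = graft P (f \<circ> g)"
proof
  fix w show "(graft P f \<circ> graft P g) w = graft P (f \<circ> g) w"
    by (cases w rule: graft_cases[of P]) (auto simp: graft_below[OF assms] graft_outside)
qed

lemma graft_id: "prefix_free P \<Longrightarrow> graft P id = id"
proof
  fix w assume "prefix_free P" then show "graft P id w = id w"
    by (cases w rule: graft_cases[of P]) (auto simp: graft_below graft_outside)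
qed

text \<open>
  Separating one element of \<open>P\<close> is how the contribution of a single pivot is isolated later.
\<close>

lemma graft_split:
  assumes "prefix_free P" "p \<in> P"
  shows "graft P f = graft {p} f \<circ> graft (P - {p}) f"
proof
  fix w
  have pf: "prefix_free (P - {p})" using assms(1) by (rule prefix_free_subset) blast
  show "graft P f w = (graft {p} f \<circ> graft (P - {p}) f) w"
  proof (cases w rule: graft_cases[of P])
    case (1 q v)
    show ?thesis
    proof (cases "q = p")
      case True
      have "\<not> (\<exists>r\<in>P - {p}. prefix r w)"
        using prefix_free_unique[OF assms(1), of p _ w] 1 True assms(2) by auto
      then show ?thesis
        using 1 True graft_below[OF assms] graft_below[of "{p}" p] by (simp add: graft_outside)
    next
      case False
      have "\<not> (\<exists>r\<in>{p}. prefix r (q @ f v))"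
        using prefix_free_unique[OF assms(1), of p q "q @ f v"] 1 False assms(2) by auto
      then show ?thesis
        using 1 False graft_below[OF assms(1)] graft_below[OF pf, of q] by (simp add: graft_outside)
    qed
  next
    case 2
    then show ?thesis using assms(2) by (simp add: graft_outside)
  qed
qed

text \<open>
  The graft is trivial off the words below \<open>P\<close>, and there \<open>t\<close> is trivial; so the two maps have
  disjoint supports.
\<close>

lemma graft_commute:
  assumes "prefix_free P" "inj t" "\<And>p w. p \<in> P \<Longrightarrow> t (p @ w) = p @ w"
  shows "t \<circ> graft P f = graft P f \<circ> t"
proof
  fix w
  show "(t \<circ> graft P f) w = (graft P f \<circ> t) w"
  proof (cases w rule: graft_cases[of P])
    case (1 p v)
    then show ?thesis using assms(3) by (simp add: graft_below[OF assms(1)])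
  next
    case 2
    have "\<not> (\<exists>p\<in>P. prefix p (t w))"
    proof
      assume "\<exists>p\<in>P. prefix p (t w)"
      then obtain p v where p: "p \<in> P" "t w = p @ v" by (auto simp: prefix_def)
      then have "t w = t (p @ v)" using assms(3) by simp
      then have "w = p @ v" using injD[OF assms(2)] by blast
      then show False using 2 p(1) by auto
    qed
    then show ?thesis using 2 by (simp add: graft_outside)
  qed
qed

lemma permutesI_inverse:
  assumes "f \<circ> g = id" "g \<circ> f = id" "\<And>x. x \<notin> S \<Longrightarrow> f x = x"
  shows "f permutes S"
  using assms o_bij[OF assms(2,1)] by (auto simp: permutes_def bij_iff)

context wreath_product
begin

text \<open>
  The portrait of a graft consists of copies of the portrait of \<open>f\<close> below the elements of \<open>P\<close>.
\<close>

lemma graft_W: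
  assumes P: "prefix_free P" "P \<subseteq> tree_words m" and f: "f \<in> W"
  shows "graft P f \<in> W"
    and "p \<in> P \<Longrightarrow> p @ v \<in> tree_words m \<Longrightarrow> label (graft P f) (p @ v) = label f v"
    and "v \<in> tree_words m \<Longrightarrow> \<not> (\<exists>p\<in>P. prefix p v) \<Longrightarrow> label (graft P f) v = id"
proof -
  define lam where "lam v = (if \<exists>p\<in>P. prefix p v
     then label f (drop (length (THE p. p \<in> P \<and> prefix p v)) v) else id)" for v
  have lam1: "lam (p @ v) = label f v" if "p \<in> P" for p v
  proof -
    have "(THE q. q \<in> P \<and> prefix q (p @ v)) = p"
      using that prefix_free_unique[OF P(1) _ that, of _ "p @ v"] by (intro the_equality) auto
    then show ?thesis using that by (auto simp: lam_def)
  qed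
  have lam2: "lam v = id" if "\<not> (\<exists>p\<in>P. prefix p v)" for v
    using that unfolding lam_def by argo
  have out: "graft P f w = w" if "w \<notin> tree_words m" for w
  proof (cases w rule: graft_cases[of P])
    case (1 p v)
    then have "v \<notin> tree_words m" using that P(2) by (auto simp: tree_words_append)
    then show ?thesis using 1 W_outside[OF f] graft_below[OF P(1)] by simp
  qed (rule graft_outside)
  have per: "graft P f permutes tree_words m"
    by (rule permutesI_inverse[where g = "graft P (Hilbert_Choice.inv f)"])
      (simp_all add: graft_comp P f graft_id out)
  have nil: "graft P f [] = []"
    by (cases "[]::nat list" rule: graft_cases[of P])
      (auto simp: graft_outside W_D(2)[OF f] dest: graft_below[OF P(1), of _ f "[]"])
  have lamH: "lam v \<in> H" if v: "v \<in> tree_words m" for v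
  proof (cases v rule: graft_cases[of P])
    case (1 p w)
    then show ?thesis using lam1 W_D(4)[OF f, of w] v by (simp add: tree_words_append)
  qed (simp add: lam2)
  have snoc: "graft P f (v @ [x]) = graft P f v @ [lam v x]" if v: "v @ [x] \<in> tree_words m" for v x
  proof (cases v rule: graft_cases[of P])
    case (1 p w)
    then show ?thesis
      using v lam1[of p w] graft_below[OF P(1) 1(1)] W_snoc[OF f, of w x]
      by (simp add: tree_words_append)
  next
    case 2
    show ?thesis
    proof (cases "v @ [x] \<in> P")
      case True
      then have "graft P f (v @ [x]) = v @ [x]"
        using graft_below[OF P(1) True, of f "[]"] W_D(2)[OF f] by simp
      then show ?thesis using 2 lam2 graft_outside by simp
    next
      case False
      then have "\<not> (\<exists>p\<in>P. prefix p (v @ [x]))" using 2 by auto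
      then show ?thesis using 2 lam2 graft_outside by simp
    qed
  qed
  note * = portrait[OF per nil lamH snoc]
  show "graft P f \<in> W" by (rule *)
  show "p \<in> P \<Longrightarrow> p @ v \<in> tree_words m \<Longrightarrow> label (graft P f) (p @ v) = label f v"
    using *(2) lam1 by simp
  show "v \<in> tree_words m \<Longrightarrow> \<not> (\<exists>p\<in>P. prefix p v) \<Longrightarrow> label (graft P f) v = id"
    using *(2) lam2 by simp
qed

lemma graft_inv:
  assumes "prefix_free P" "P \<subseteq> tree_words m" "f \<in> W"
  shows "Hilbert_Choice.inv (graft P f) = graft P (Hilbert_Choice.inv f)"
  by (rule inv_unique_comp) (simp_all add: graft_comp graft_id assms)

lemma root_perm_W:
  assumes h: "h \<in> H"
  shows "root_perm m h \<in> W"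
    and "v \<in> tree_words m \<Longrightarrow> label (root_perm m h) v = (if v = [] then h else id)"
proof -
  have hx: "k x \<in> {1..m} \<longleftrightarrow> x \<in> {1..m}" if "k \<in> H" for k x
    using permutes_in_image[OF H_permutes[OF that]] .
  have comp: "root_perm m k (root_perm m l w) = root_perm m (k \<circ> l) w" if "k \<in> H" "l \<in> H" for k l w
    using hx[OF that(2)] by (cases w) (auto simp: root_perm_def tree_words_def)
  have one: "root_perm m id = id"
    by (auto simp: root_perm_def fun_eq_iff)
  have "root_perm m h permutes tree_words m"
    using comp h one permutes_inv_o[OF H_permutes[OF h]]
    by (intro permutesI_inverse[where g = "root_perm m (Hilbert_Choice.inv h)"])
      (auto simp: fun_eq_iff, auto simp: root_perm_def)
  note * = portrait[OF this, of "\<lambda>v. if v = [] then h else id"]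
  have "root_perm m h [] = []" by (simp add: root_perm_def)
  moreover have "root_perm m h (v @ [x]) = root_perm m h v @ [(if v = [] then h else id) x]"
    if "v @ [x] \<in> tree_words m" for v x
    using that tree_words_append[of v "[x]" m] by (cases v) (auto simp: root_perm_def)
  ultimately show "root_perm m h \<in> W"
    and "v \<in> tree_words m \<Longrightarrow> label (root_perm m h) v = (if v = [] then h else id)"
    using * h by auto
qed

lemma root_perm_Cons: "a # w \<in> tree_words m \<Longrightarrow> root_perm m h (a # w) = h a # w"
  by (simp add: root_perm_def)

abbreviation "mark P h \<equiv> graft P (root_perm m h)"

lemma mark_W: "prefix_free P \<Longrightarrow> P \<subseteq> tree_words m \<Longrightarrow> h \<in> H \<Longrightarrow> mark P h \<in> W"
  by (simp add: graft_W(1) root_perm_W(1))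

lemma label_mark:
  assumes "prefix_free P" "P \<subseteq> tree_words m" "h \<in> H" "v \<in> tree_words m"
  shows "label (mark P h) v = (if v \<in> P then h else id)"
proof (cases v rule: graft_cases[of P])
  case (1 p w)
  have "v \<in> P \<longleftrightarrow> w = []"
    using prefix_free_unique[OF assms(1) 1(1), of v v] 1 by auto
  then show ?thesis
    using 1 graft_W(2)[OF assms(1,2) root_perm_W(1)[OF assms(3)]] root_perm_W(2)[OF assms(3), of w]
      assms(4) by (simp add: tree_words_append)
next
  case 2
  then show ?thesis
    using graft_W(3)[OF assms(1,2) root_perm_W(1)[OF assms(3)] assms(4)] by auto
qed

lemma mark_snoc:
  assumes "prefix_free P" "P \<subseteq> tree_words m" "h \<in> H" "p \<in> P" "p @ [x] \<in> tree_words m"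
  shows "mark P h (p @ [x]) = p @ [h x]"
  using graft_below[OF assms(1,4), of "root_perm m h" "[x]"] assms(5) root_perm_Cons
  by (simp add: tree_words_append)

lemma mark_fixes_above:
  assumes "prefix_free P" "P \<subseteq> tree_words m" "h \<in> H" "\<not> (\<exists>p\<in>P. strict_prefix p w)"
  shows "mark P h w = w"
proof (cases w rule: graft_cases[of P])
  case (1 p v)
  then have "v = []" using assms(4) by (auto simp: strict_prefix_def)
  then show ?thesis using 1 graft_below[OF assms(1) 1(1), of "root_perm m h" "[]"]
    by (simp add: root_perm_def)
qed (rule graft_outside)

lemma generate_W:
  assumes "S \<subseteq> W"
  shows "subgroup (generate (wreath m H) S) (wreath m H)" "S \<subseteq> generate (wreath m H) S"
  using group.generate_is_subgroup[OF group_wreath assms] by (auto intro: generate.incl)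

lemma generate_W_induct [consumes 2, case_names id mem inv comp]:
  assumes "S \<subseteq> W" "g \<in> generate (wreath m H) S"
    and "P id" "\<And>s. s \<in> S \<Longrightarrow> P s" "\<And>s. s \<in> S \<Longrightarrow> P (Hilbert_Choice.inv s)"
    and "\<And>a b. a \<in> W \<Longrightarrow> b \<in> W \<Longrightarrow> P a \<Longrightarrow> P b \<Longrightarrow> P (a \<circ> b)"
  shows "P g"
  using assms(2)
proof (induction rule: generate.induct)
  case one
  then show ?case unfolding wreath_one by (rule assms(3))
next
  case (inv h)
  then show ?case using assms(1,5) wreath_inv by auto
next
  case (eng a b)
  then show ?case
    unfolding wreath_mult using assms(6)[of a b] subgroup_W_D(5)[OF generate_W(1)[OF assms(1)]] by blast
qed (use assms in auto)

end

section \<open>Level-transitivity of a spinal group\<close>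

definition spurs :: "nat set \<Rightarrow> nat list set"
  where "spurs J = {replicate j 1 @ [2] | j. j \<in> J}"

text \<open>
  The difference at \<open>l\<close> is the first one; positions are counted from 0, so that \<open>1\<^sup>l2\<close> leaves the ray
  at position \<open>l\<close>.
\<close>

definition forks_evenly :: "nat list \<Rightarrow> nat list \<Rightarrow> bool"
  where "forks_evenly u w \<longleftrightarrow>
    (\<exists>l. even l \<and> l < length u \<and> l < length w \<and> take l u = take l w \<and> u ! l \<noteq> w ! l)"

lemma prefix_free_spurs: "prefix_free (spurs J)"
proof -
  have "i = j" if "prefix (replicate i 1 @ [2]) (replicate j 1 @ [2::nat])" for i j
  proof (rule ccontr)
    assume "i \<noteq> j"
    moreover have "i \<le> j" using prefix_length_le[OF that] by simp
    ultimately have "i < j" by simp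
    moreover have "(replicate j 1 @ [2::nat]) ! i = (replicate i 1 @ [2]) ! i"
      using nth_prefix[OF that, of i] by simp
    ultimately show False by (simp add: nth_append)
  qed
  then show ?thesis unfolding prefix_free_def spurs_def by blast
qed

lemma not_spur_prefix_ray: "p \<in> spurs J \<Longrightarrow> \<not> prefix p (replicate n 1)"
  by (auto simp: spurs_def dest!: set_mono_prefix)

lemma not_spur_prefix:
  assumes "c \<noteq> 1" "l \<notin> J" "p \<in> spurs J"
  shows "\<not> prefix p (replicate l 1 @ c # w)"
proof
  assume p: "prefix p (replicate l 1 @ c # w)"
  obtain j where j: "p = replicate j 1 @ [2]" "j \<in> J" using assms(3) by (auto simp: spurs_def)
  have nth: "(replicate l 1 @ c # w) ! i = p ! i" if "i \<le> j" for i
    using nth_prefix[OF p, of i] that j(1) by simp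
  have "l \<noteq> j" using assms(2) j(2) by blast
  then consider "j < l" | "l < j" by linarith
  then show False
    using nth[of j] nth[of l] assms(1) j(1) by cases (simp_all add: nth_append)
qed

locale transitive_wreath_product = wreath_product +
  assumes transitive: "\<forall>x\<in>{1..m}. \<forall>y\<in>{1..m}. \<exists>h\<in>H. h x = y"
begin

lemma spurs_words: "spurs J \<subseteq> tree_words m"
  using m2 by (auto simp: spurs_def tree_words_def)

lemma ray_level: "replicate n 1 \<in> level m n"
  using m2 by (auto simp: level_def tree_words_def)

definition "spinal = generate (wreath m H)
  (root_perm m ` H \<union> mark (spurs {j. even j}) ` H \<union> mark (spurs {j. odd j}) ` H)"

lemma spinal_gens_W:
  "root_perm m ` H \<union> mark (spurs {j. even j}) ` H \<union> mark (spurs {j. odd j}) ` H \<subseteq> W"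
  using root_perm_W(1) mark_W[OF prefix_free_spurs spurs_words] by auto

lemma spinal_subgroup: "subgroup spinal (wreath m H)"
  unfolding spinal_def by (rule generate_W(1)[OF spinal_gens_W])

lemmas spinal_D = subgroup_W_D[OF spinal_subgroup]

lemma spinal_gens:
  "h \<in> H \<Longrightarrow> root_perm m h \<in> spinal"
  "h \<in> H \<Longrightarrow> mark (spurs {j. even j}) h \<in> spinal"
  "h \<in> H \<Longrightarrow> mark (spurs {j. odd j}) h \<in> spinal"
  unfolding spinal_def using generate_W(2)[OF spinal_gens_W] by blast+

text \<open>
  Each level except the root carries exactly one spur, and marking it permutes its children
  transitively.
\<close>

lemma spur_mover:
  assumes "b \<in> {1..m}" "c \<in> {1..m}"
  shows "\<exists>s\<in>spinal. s (replicate n 1 @ [2, b]) = replicate n 1 @ [2, c]"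
proof -
  obtain h where h: "h \<in> H" "h b = c" using transitive assms by blast
  \<comment> \<open>The even and the odd spurs together cover all levels.\<close>
  define J where "J = (if even n then {j::nat. even j} else {j. odd j})"
  have "mark (spurs J) h \<in> spinal" using spinal_gens h(1) by (simp add: J_def)
  moreover have "replicate n 1 @ [2] \<in> spurs J" by (auto simp: spurs_def J_def)
  then have "mark (spurs J) h ((replicate n 1 @ [2]) @ [b]) = (replicate n 1 @ [2]) @ [h b]"
    using assms(1) m2
    by (intro mark_snoc[OF prefix_free_spurs spurs_words h(1)]) (auto simp: tree_words_def)
  ultimately show ?thesis using h(2) by auto
qed

text \<open>
  By induction the vertex above \<open>w\<close> can be carried to the spur on its level, where the last letter
  can be changed at will. So all words on the next level lie in the orbit of a child of the spur.
\<close>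

lemma spinal_transitive:
  assumes "w \<in> level m n"
  shows "\<exists>g\<in>spinal. g (replicate n 1) = w"
  using assms
proof (induction n arbitrary: w)
  case 0
  then show ?case using spinal_D(2) by (auto simp: level_def intro!: bexI[of _ id])
next
  case (Suc n)
  then obtain v a where w: "w = v @ [a]" "v \<in> level m n" "a \<in> {1..m}"
    by (elim level_SucE)
  show ?case
  proof (cases n)
    case 0
    obtain h where h: "h \<in> H" "h 1 = a" using transitive w(3) m2 by force
    have "root_perm m h (replicate (Suc n) 1) = w"
      using 0 w h(2) m2 by (simp add: root_perm_def level_def tree_words_def)
    then show ?thesis using spinal_gens(1)[OF h(1)] by blast
  next
    case (Suc k)
    let ?q = "replicate k 1 @ [2]"
    have q: "?q \<in> level m n" using m2 Suc by (auto simp: level_def tree_words_def)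
    obtain g1 where g1: "g1 \<in> spinal" "g1 (replicate n 1) = v" using Suc.IH w(2) by blast
    obtain g2 where g2: "g2 \<in> spinal" "g2 (replicate n 1) = ?q" using Suc.IH q by blast
    define g where "g = g2 \<circ> Hilbert_Choice.inv g1"
    have g: "g \<in> spinal" "g v = ?q"
      using g1 g2 spinal_D(3,4,5) by (auto simp: g_def)
    have lvl: "w \<in> tree_words m" "replicate n 1 @ [1] \<in> tree_words m"
      using Suc.prems m2 by (auto simp: level_def tree_words_def)
    obtain b where b: "g w = ?q @ [b]" "b \<in> {1..m}"
      using W_child[OF spinal_D(5)[OF g(1)], of v a] g(2) w(1) lvl(1) by metis
    obtain c where c: "g2 (replicate n 1 @ [1]) = ?q @ [c]" "c \<in> {1..m}"
      using W_child[OF spinal_D(5)[OF g2(1)] lvl(2)] g2(2) by metis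
    obtain s where s: "s \<in> spinal" "s (?q @ [c]) = ?q @ [b]"
      using spur_mover[OF c(2) b(2), of k] by auto
    have "(Hilbert_Choice.inv g \<circ> s \<circ> g2) (replicate n 1 @ [1]) = w"
      using c(1) s(2) b(1) spinal_D(5)[OF g(1)] W_inverse(2)[of g w] by simp
    moreover have "replicate (Suc n) 1 = replicate n 1 @ [1::nat]"
      by (simp add: replicate_append_same)
    ultimately show ?thesis
      using spinal_D(3,4) g(1) s(1) g2(1) by metis
  qed
qed

lemma spinal_transitive2:
  assumes "v \<in> level m n" "w \<in> level m n"
  shows "\<exists>g\<in>spinal. g v = w"
proof -
  obtain g where g: "g \<in> spinal" "g (replicate n 1) = v" using spinal_transitive assms(1) by blast
  obtain k where k: "k \<in> spinal" "k (replicate n 1) = w" using spinal_transitive assms(2) by blast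
  show ?thesis
    using g k spinal_D(3,4,5) by (intro bexI[of _ "k \<circ> Hilbert_Choice.inv g"]) auto
qed

section \<open>Conjugates that move words only at odd positions\<close>

text \<open>
  The conjugator \<open>g\<close> carries the ray \<open>1\<^sup>k\<close> to \<open>u\<close>. The mark moves words that leave the ray through
  an odd spur, so its conjugate moves only words that leave \<open>u\<close> at an odd position or lie below \<open>u\<close>.
\<close>

definition "side_gens u = {g \<circ> mark (spurs {j. odd j}) h \<circ> Hilbert_Choice.inv g | g h.
  g \<in> spinal \<and> h \<in> H \<and> g (replicate (length u) 1) = u}"

definition "side_group u = generate (wreath m H) (side_gens u)"

lemma side_gens_spinal: "side_gens u \<subseteq> spinal"
  using spinal_D(3,4) spinal_gens(3) by (auto simp: side_gens_def)

lemma side_group_subgroup: "subgroup (side_group u) (wreath m H)"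
  unfolding side_group_def by (rule generate_W(1)) (use side_gens_spinal spinal_D(1) in blast)

lemmas side_group_D = subgroup_W_D[OF side_group_subgroup]

lemma side_gens_subset: "side_gens u \<subseteq> side_group u"
  unfolding side_group_def by (rule generate_W(2)) (use side_gens_spinal spinal_D(1) in blast)

lemma side_group_spinal: "side_group u \<subseteq> spinal"
  unfolding side_group_def
  using group.generate_subgroup_incl[OF group_wreath side_gens_spinal spinal_subgroup] .

lemma side_group_fixes:
  assumes "t \<in> side_group u" and "\<And>s. s \<in> side_gens u \<Longrightarrow> s w = w"
  shows "t w = w"
proof -
  have S: "side_gens u \<subseteq> W" using side_gens_spinal spinal_D(1) by blast
  show ?thesis
  proof (rule generate_W_induct[OF S, of t "\<lambda>t. t w = w"])
    fix s assume "s \<in> side_gens u"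
    then have "s w = w" "s \<in> W" using assms(2) S by auto
    then show "Hilbert_Choice.inv s w = w" using W_inverse(2)[of s w] by simp
  qed (use assms in \<open>auto simp: side_group_def\<close>)
qed

text \<open>
  Carried back by the conjugator, a word that leaves \<open>u\<close> at an even position leaves the ray there,
  and hence lies below no odd spur.
\<close>

lemma side_group_fixes_forks:
  assumes t: "t \<in> side_group u" and u: "u \<in> tree_words m" and w: "w \<in> tree_words m"
    and fork: "forks_evenly u w"
  shows "t w = w"
proof (rule side_group_fixes[OF t])
  fix s assume "s \<in> side_gens u"
  then obtain g h where s: "s = g \<circ> mark (spurs {j. odd j}) h \<circ> Hilbert_Choice.inv g"
    and g: "g \<in> spinal" "g (replicate (length u) 1) = u" and h: "h \<in> H"
    by (auto simp: side_gens_def)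
  obtain l where l: "even l" "l < length u" "l < length w" "take l u = take l w" "u ! l \<noteq> w ! l"
    using fork by (auto simp: forks_evenly_def)
  have gW: "g \<in> W" using g spinal_D by blast
  define v where "v = Hilbert_Choice.inv g w"
  have gv: "g v = w" "v \<in> tree_words m" "length v = length w"
    using gW w by (auto simp: v_def)
  have eq: "take i v = replicate i 1 \<longleftrightarrow> take i w = take i u" if "i \<le> length u" for i
  proof -
    have "take i u = g (replicate i 1)"
      using W_take[OF gW, of "replicate (length u) 1" i] g(2) ray_level[of "length u"] that
      by (simp add: level_def min_absorb1)
    moreover have "take i w = g (take i v)" using W_take[OF gW gv(2)] gv(1) by simp
    ultimately show ?thesis using gW by simp
  qed
  have "take l v = replicate l 1" using eq[of l] l(2,4) by simp
  moreover have "take (Suc l) v \<noteq> replicate (Suc l) 1"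
    using eq[of "Suc l"] l by (simp add: take_Suc_conv_app_nth)
  ultimately have "v ! l \<noteq> 1"
    using l(3) gv(3) replicate_append_same[of l "1::nat"] by (auto simp: take_Suc_conv_app_nth)
  moreover have "v = replicate l 1 @ v ! l # drop (Suc l) v"
    using id_take_nth_drop[of l v] l(3) gv(3) \<open>take l v = replicate l 1\<close> by simp
  ultimately have "\<not> prefix p v" if "p \<in> spurs {j. odd j}" for p
    using not_spur_prefix[of "v ! l" l "{j. odd j}" p "drop (Suc l) v"] l(1) that by simp
  then have "mark (spurs {j. odd j}) h v = v"
    by (intro graft_outside) blast
  then show "s w = w" using gv(1) by (simp add: s v_def)
qed

lemma side_group_fixes_root:
  assumes t: "t \<in> side_group u"
  shows "t u = u"
proof (rule side_group_fixes[OF t])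
  fix s assume "s \<in> side_gens u"
  then obtain g h where s: "s = g \<circ> mark (spurs {j. odd j}) h \<circ> Hilbert_Choice.inv g"
    and g: "g \<in> spinal" "g (replicate (length u) 1) = u"
    by (auto simp: side_gens_def)
  have "Hilbert_Choice.inv g u = replicate (length u) 1"
    using g spinal_D(5) W_inverse(2) by metis
  moreover have "mark (spurs {j. odd j}) h (replicate (length u) 1) = replicate (length u) 1"
    by (rule graft_outside) (use not_spur_prefix_ray in blast)
  ultimately show "s u = u" using g(2) by (simp add: s)
qed

text \<open>
  As \<open>v\<close> has even length it is the image of an odd spur under an element of the spinal group; this
  element carries \<open>1\<^sup>k\<close> to the prefix \<open>u\<close> of \<open>v\<close>, so it may be used as a conjugator.
\<close>

lemma side_group_children:
  assumes v: "v \<in> tree_words m" "prefix u v" "even (length v)" "length u < length v"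
    and ab: "a \<in> {1..m}" "b \<in> {1..m}"
  shows "\<exists>t\<in>side_group u. t (v @ [a]) = v @ [b]"
proof -
  obtain j where j: "length v = Suc j" using v(4) by (cases "length v") auto
  let ?p = "replicate j 1 @ [2::nat]"
  have p: "?p \<in> level m (Suc j)" using m2 by (auto simp: level_def tree_words_def)
  obtain g where g: "g \<in> spinal" "g ?p = v"
    using spinal_transitive2[OF p, of v] v(1) j by (auto simp: level_def)
  have gW: "g \<in> W" using g spinal_D by blast
  have u: "g (replicate (length u) 1) = u"
  proof -
    have "u = take (length u) v" using v(2) by (auto simp: prefix_def)
    also have "\<dots> = g (take (length u) ?p)" using W_take[OF gW, of ?p] p g(2) by (simp add: level_def)
    also have "take (length u) ?p = replicate (length u) 1" using v(4) j by (simp add: min_absorb1)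
    finally show ?thesis by simp
  qed
  have gchild: "\<exists>y\<in>{1..m}. g (?p @ [y]) = v @ [x]" if x: "x \<in> {1..m}" for x
  proof -
    have vx: "v @ [x] \<in> tree_words m" using v(1) x by (simp add: tree_words_snoc)
    then have "Hilbert_Choice.inv g (v @ [x]) \<in> tree_words m" using gW by simp
    moreover have "Hilbert_Choice.inv g (v @ [x]) = ?p @ [label (Hilbert_Choice.inv g) v x]"
      using W_snoc[OF W_inv[OF gW] vx] g(2) W_inverse(2)[OF gW, of ?p] by simp
    ultimately show ?thesis
      using W_inverse(1)[OF gW, of "v @ [x]"] by (metis tree_words_snoc)
  qed
  obtain a' where a': "a' \<in> {1..m}" "g (?p @ [a']) = v @ [a]" using gchild[OF ab(1)] by blast
  obtain b' where b': "b' \<in> {1..m}" "g (?p @ [b']) = v @ [b]" using gchild[OF ab(2)] by blast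
  obtain h where h: "h \<in> H" "h a' = b'" using transitive a' b' by blast
  have "?p \<in> spurs {j. odd j}" using v(3) j by (auto simp: spurs_def)
  then have "mark (spurs {j. odd j}) h (?p @ [a']) = ?p @ [b']"
    using mark_snoc[OF prefix_free_spurs spurs_words h(1), of ?p _ a'] p a'(1) h(2) m2
    by (simp add: level_def tree_words_def)
  moreover have "Hilbert_Choice.inv g (v @ [a]) = ?p @ [a']"
    using a'(2) W_inverse(2)[OF gW] by metis
  ultimately have "(g \<circ> mark (spurs {j. odd j}) h \<circ> Hilbert_Choice.inv g) (v @ [a]) = v @ [b]"
    using b'(2) by simp
  moreover have "g \<circ> mark (spurs {j. odd j}) h \<circ> Hilbert_Choice.inv g \<in> side_gens u"
    using g(1) h(1) u unfolding side_gens_def by blast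
  ultimately show ?thesis using side_gens_subset by blast
qed

text \<open>
  Going down the tree from \<open>u\<close>, the orbit is multiplied by \<open>m\<close> at each even level strictly below
  \<open>u\<close>, since there the children of every vertex below \<open>u\<close> are permuted transitively. The exponent
  counts the even levels strictly between \<open>u\<close> and \<open>v\<close>.
\<close>

lemma side_group_orbit:
  assumes u: "even (length u)" "prefix u v" and v: "v \<in> level m l"
  shows "m ^ ((l - length u - 1) div 2) \<le> card ((\<lambda>t. t v) ` side_group u)"
  using u(2) v
proof (induction l arbitrary: v)
  case 0
  have "finite ((\<lambda>t. t v) ` side_group u)"
    by (rule finite_subset[OF _ finite_level[of m 0]]) (use 0 side_group_D(5) in auto)
  moreover have "(\<lambda>t. t v) ` side_group u \<noteq> {}" using side_group_D(2) by blast
  ultimately show ?case by (simp add: Suc_leI card_gt_0_iff)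
next
  case (Suc l)
  let ?orb = "\<lambda>v. (\<lambda>t. t v) ` side_group u"
  have fin: "finite (?orb w)" if "w \<in> level m n" for w n
    by (rule finite_subset[OF _ finite_level[of m n]]) (use that side_group_D(5) in auto)
  show ?case
  proof (cases "length u < Suc l")
    case False
    have "?orb v \<noteq> {}" using side_group_D(2) by blast
    then show ?thesis using False fin[OF Suc.prems(2)] by (simp add: Suc_leI card_gt_0_iff)
  next
    case True
    obtain w a where w: "v = w @ [a]" "w \<in> level m l" "a \<in> {1..m}"
      using Suc.prems(2) by (elim level_SucE)
    have uw: "prefix u w"
      using Suc.prems True w by (auto simp: level_def)
    have wlen: "length w = l" "w \<in> tree_words m" using w(2) by (auto simp: level_def)
    note IH = Suc.IH[OF uw w(2)]
    have child: "\<exists>y\<in>{1..m}. t v = t w @ [y]" if "t \<in> side_group u" for t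
    proof -
      have "w @ [a] \<in> tree_words m" using w wlen by (simp add: tree_words_snoc)
      then show ?thesis using W_child[OF side_group_D(5)[OF that]] w(1) by blast
    qed
    show ?thesis
    proof (cases "even l \<and> length u < l")
      case True
      have "(\<lambda>(w', b). w' @ [b]) ` (?orb w \<times> {1..m}) \<subseteq> ?orb v"
      proof clarify
        fix t b assume t: "t \<in> side_group u" and b: "b \<in> {1..m}"
        obtain y where y: "y \<in> {1..m}" "t v = t w @ [y]" using child[OF t] by blast
        have tW: "t \<in> W" using t side_group_D by blast
        have "t w \<in> tree_words m" "length (t w) = l" using tW wlen by auto
        moreover have "prefix u (t w)"
          using W_take[OF tW, of w "length u"] side_group_fixes_root[OF t] uw wlen
          by (metis append_eq_conv_conj prefix_def take_is_prefix)
        ultimately obtain s where "s \<in> side_group u" "s (t w @ [y]) = t w @ [b]"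
          using side_group_children[of "t w" u y b] True y(1) b by auto
        then show "t w @ [b] \<in> ?orb v"
          using y(2) side_group_D(3) t by (intro image_eqI[of _ _ "s \<circ> t"]) auto
      qed
      then have "card ((\<lambda>(w', b). w' @ [b]) ` (?orb w \<times> {1..m})) \<le> card (?orb v)"
        using fin[OF Suc.prems(2)] card_mono by blast
      moreover have "card ((\<lambda>(w', b). w' @ [b]) ` (?orb w \<times> {1..m})) = card (?orb w) * m"
        by (subst card_image) (auto simp: inj_on_def card_cartesian_product)
      ultimately have "card (?orb w) * m \<le> card (?orb v)" by simp
      moreover have "(Suc l - length u - 1) div 2 = Suc ((l - length u - 1) div 2)"
        using True u(1) by presburger
      ultimately show ?thesis
        using le_trans[OF mult_le_mono1[OF IH, of m]] by (simp only: power_Suc2)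
    next
      case False
      have "?orb w \<subseteq> butlast ` ?orb v"
      proof clarify
        fix t assume t: "t \<in> side_group u"
        then have "t w = butlast (t v)" using child[OF t] by auto
        then show "t w \<in> butlast ` ?orb v" using t by blast
      qed
      then have "card (?orb w) \<le> card (?orb v)"
        using fin[OF Suc.prems(2)] by (meson card_image_le card_mono finite_imageI le_trans)
      moreover have "(Suc l - length u - 1) div 2 = (l - length u - 1) div 2"
        using False True u(1) by presburger
      ultimately show ?thesis using IH by simp
    qed
  qed
qed

end

context wreath_product
begin

section \<open>Growth of the number of actions from level to level\<close>

abbreviation "actions n G \<equiv> (\<lambda>g. restrict g (level m n)) ` G"

lemma finite_actions: "G \<subseteq> W \<Longrightarrow> finite (actions n G)"
  by (rule finite_subset[of _ "level m n \<rightarrow>\<^sub>E level m n"]) (auto intro: finite_PiE)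

lemma same_action: "restrict g (level m n) = restrict k (level m n) \<longleftrightarrow> (\<forall>w\<in>level m n. g w = k w)"
  by (auto simp: restrict_def fun_eq_iff)

text \<open>
  If elements of the \<open>n\<close>-th level stabilizer adjust the labels at the vertices of \<open>B\<close> one at a
  time, their products realize every function from \<open>B\<close> to \<open>H\<close>, because labels multiply pointwise
  there. Each action on level \<open>n\<close> then extends in at least \<open>card H ^ card B\<close> ways.
\<close>

lemma layer_growth:
  assumes G: "subgroup G (wreath m H)" and B: "B \<subseteq> level m n"
    and ex: "\<And>q h. q \<in> B \<Longrightarrow> h \<in> H \<Longrightarrow> \<exists>z\<in>G. (\<forall>w\<in>level m n. z w = w) \<and> label z q = h \<and>
      (\<forall>v\<in>B - {q}. label z v = id)"
  shows "card (actions n G) * card H ^ card B \<le> card (actions (Suc n) G)"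
proof -
  note GD = subgroup_W_D[OF G]
  have fin: "finite B" using B finite_level finite_subset by blast
  have words: "v \<in> tree_words m" if "v \<in> B" for v using B that by (auto simp: level_def)
  have part: "\<exists>z\<in>G. (\<forall>w\<in>level m n. z w = w) \<and> (\<forall>q\<in>F. label z q = f q) \<and> (\<forall>v\<in>B - F. label z v = id)"
    if "finite F" "F \<subseteq> B" "\<forall>q\<in>F. f q \<in> H" for F f
    using that
  proof (induction F rule: finite_induct)
    case empty
    then show ?case using GD(2) by (auto intro!: bexI[of _ id])
  next
    case (insert q F)
    have "F \<subseteq> B" "\<forall>q\<in>F. f q \<in> H" using insert.prems by auto
    then obtain z where z: "z \<in> G" "\<forall>w\<in>level m n. z w = w" "\<forall>q\<in>F. label z q = f q"
      "\<forall>v\<in>B - F. label z v = id" using insert.IH by blast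
    obtain y where y: "y \<in> G" "\<forall>w\<in>level m n. y w = w" "label y q = f q" "\<forall>v\<in>B - {q}. label y v = id"
      using ex[of q "f q"] insert.prems by auto
    have "label (z \<circ> y) v = label z v \<circ> label y v" if "v \<in> B" for v
      using label_comp[of z y v] GD(5) z y words B that by auto
    then have lab: "\<And>v. v \<in> B \<Longrightarrow> label (z \<circ> y) v = label z v \<circ> label y v" .
    have "\<forall>p\<in>insert q F. label z p \<circ> label y p = f p"
    proof -
      have "p \<in> B - {q}" if "p \<in> F" for p using that insert.prems insert.hyps(2) by auto
      then show ?thesis using z(3,4) y(3,4) insert.prems insert.hyps(2) by auto
    qed
    moreover have "\<forall>v\<in>B - insert q F. label z v \<circ> label y v = id"
      using z(4) y(4) by auto
    ultimately have "\<forall>p\<in>insert q F. label (z \<circ> y) p = f p" "\<forall>v\<in>B - insert q F. label (z \<circ> y) v = id"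
      using lab insert.prems(1) by (simp_all add: subset_iff)
    moreover have "\<forall>w\<in>level m n. (z \<circ> y) w = w" using z(2) y(2) by simp
    ultimately show ?case using GD(3)[OF z(1) y(1)] by blast
  qed
  have "\<forall>f\<in>B \<rightarrow>\<^sub>E H. \<exists>z. z \<in> G \<and> (\<forall>w\<in>level m n. z w = w) \<and> (\<forall>q\<in>B. label z q = f q)"
  proof
    fix f assume "f \<in> B \<rightarrow>\<^sub>E H"
    then have "\<forall>q\<in>B. f q \<in> H" by auto
    from part[OF fin subset_refl this]
    show "\<exists>z. z \<in> G \<and> (\<forall>w\<in>level m n. z w = w) \<and> (\<forall>q\<in>B. label z q = f q)"
      by (elim bexE) (intro exI, elim conjE, intro conjI, assumption+)
  qed
  from bchoice[OF this] obtain z where z0: "\<forall>f\<in>B \<rightarrow>\<^sub>E H. z f \<in> G \<and>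
    (\<forall>w\<in>level m n. z f w = w) \<and> (\<forall>q\<in>B. label (z f) q = f q)" ..
  have z: "\<And>f. f \<in> B \<rightarrow>\<^sub>E H \<Longrightarrow> z f \<in> G"
    "\<And>f w. f \<in> B \<rightarrow>\<^sub>E H \<Longrightarrow> w \<in> level m n \<Longrightarrow> z f w = w"
    "\<And>f q. f \<in> B \<rightarrow>\<^sub>E H \<Longrightarrow> q \<in> B \<Longrightarrow> label (z f) q = f q"
    by (use z0 in simp)+
  define g where "g = inv_into G (\<lambda>g. restrict g (level m n))"
  have g: "g a \<in> G \<and> restrict (g a) (level m n) = a" if "a \<in> actions n G" for a
    unfolding g_def using inv_into_into[OF that] f_inv_into_f[OF that] by blast
  let ?F = "\<lambda>(a, f). restrict (g a \<circ> z f) (level m (Suc n))"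
  have "inj_on ?F (actions n G \<times> (B \<rightarrow>\<^sub>E H))"
  proof (rule inj_onI, clarify)
    fix k1 k2 f1 f2 :: "nat list \<Rightarrow> _"
    let ?a = "\<lambda>k. restrict k (level m n)"
    assume k: "k1 \<in> G" "k2 \<in> G" and f: "f1 \<in> B \<rightarrow>\<^sub>E H" "f2 \<in> B \<rightarrow>\<^sub>E H"
      and eq: "restrict (g (?a k1) \<circ> z f1) (level m (Suc n)) = restrict (g (?a k2) \<circ> z f2) (level m (Suc n))"
    have gk: "g (?a k) \<in> G" "?a (g (?a k)) = ?a k" if "k \<in> G" for k using g that by auto
    have eq': "\<forall>w\<in>level m (Suc n). (g (?a k1) \<circ> z f1) w = (g (?a k2) \<circ> z f2) w"
      using eq by (simp only: same_action)
    have "(g (?a k1) \<circ> z f1) w = (g (?a k2) \<circ> z f2) w" if "w \<in> level m n" for w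
    proof (rule agree_below[OF _ _ eq'])
      show "g (?a k1) \<circ> z f1 \<in> W" "g (?a k2) \<circ> z f2 \<in> W"
        using GD(5)[OF GD(3)[OF gk(1)[OF k(1)] z(1)[OF f(1)]]]
          GD(5)[OF GD(3)[OF gk(1)[OF k(2)] z(1)[OF f(2)]]] .
    qed (use that in \<open>auto simp: level_def\<close>)
    then have "?a (g (?a k1)) = ?a (g (?a k2))"
      unfolding same_action using z(2) f by simp
    then have a: "?a k1 = ?a k2" using gk k by simp
    have zz: "z f1 w = z f2 w" if "w \<in> level m (Suc n)" for w
      using eq' that GD(5) gk(1)[OF k(1)] unfolding a by simp
    have "f1 q = f2 q" if q: "q \<in> B" for q
    proof
      fix x
      have fH: "f1 q \<in> H" "f2 q \<in> H" using f q by auto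
      show "f1 q x = f2 q x"
      proof (cases "x \<in> {1..m}")
        case True
        then have "q @ [x] \<in> level m (Suc n)" using B q by (auto simp: level_Suc)
        then have "z f1 (q @ [x]) = z f2 (q @ [x])" "q @ [x] \<in> tree_words m"
          using zz by (auto simp: level_def)
        then show ?thesis
          using W_snoc[of "z f1" q x] W_snoc[of "z f2" q x] z f q GD(5) B by auto
      next
        case False
        then show ?thesis using fH H_permutes permutes_not_in by metis
      qed
    qed
    then have "f1 = f2" using f by (intro PiE_ext[of f1 B "\<lambda>_. H" f2]) auto
    then show "?a k1 = ?a k2 \<and> f1 = f2" using a by simp
  qed
  moreover have "?F ` (actions n G \<times> (B \<rightarrow>\<^sub>E H)) \<subseteq> actions (Suc n) G"
  proof clarify
    fix k f assume "k \<in> G" "f \<in> B \<rightarrow>\<^sub>E H"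
    then have "g (restrict k (level m n)) \<circ> z f \<in> G" using g z(1) GD(3) by blast
    then show "restrict (g (restrict k (level m n)) \<circ> z f) (level m (Suc n)) \<in> actions (Suc n) G"
      by blast
  qed
  ultimately have "card (actions n G \<times> (B \<rightarrow>\<^sub>E H)) \<le> card (actions (Suc n) G)"
    using card_inj_on_le finite_actions[OF GD(1)] by blast
  then show ?thesis by (simp add: card_cartesian_product card_PiE[OF fin])
qed

text \<open>
  The action on level \<open>n\<close> is determined by the labels above that level.
\<close>

lemma card_actions_le:
  assumes G: "G \<subseteq> W" and V: "finite V"
    and triv: "\<And>g v. g \<in> G \<Longrightarrow> v \<in> tree_words m \<Longrightarrow> length v < n \<Longrightarrow> v \<notin> V \<Longrightarrow> label g v = id"
    and V_words: "V \<subseteq> tree_words m"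
  shows "card (actions n G) \<le> card H ^ card V"
proof -
  let ?lab = "\<lambda>g. restrict (label g) V"
  have det: "g w = k w" if gk: "g \<in> G" "k \<in> G" "?lab g = ?lab k" and w: "w \<in> tree_words m" "length w \<le> n"
    for g k w
    using w
  proof (induction w rule: rev_induct)
    case Nil
    then show ?case using gk(1,2) G W_D(2) by (metis subsetD)
  next
    case (snoc x w)
    have w: "w \<in> tree_words m" "length w < n" using snoc.prems by (auto simp: tree_words_snoc)
    have "label g w = label k w"
    proof (cases "w \<in> V")
      case True
      then show ?thesis using gk(3) by (metis restrict_apply')
    qed (use triv gk w in simp)
    moreover have "g w = k w" using snoc.IH w by simp
    moreover have "g \<in> W" "k \<in> W" using G gk by auto
    ultimately show ?case
      using W_snoc[of g w x] W_snoc[of k w x] snoc.prems(1) by simp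
  qed
  have "restrict g (level m n) = restrict (inv_into G ?lab (?lab g)) (level m n)" if g: "g \<in> G" for g
  proof -
    have "inv_into G ?lab (?lab g) \<in> G" "?lab (inv_into G ?lab (?lab g)) = ?lab g"
      using g inv_into_into[of "?lab g" ?lab G] f_inv_into_f[of "?lab g" ?lab G] by blast+
    then show ?thesis
      unfolding same_action using det[OF g] by (auto simp: level_def)
  qed
  then have sub: "actions n G \<subseteq> (\<lambda>f. restrict (inv_into G ?lab f) (level m n)) ` ?lab ` G"
    by blast
  have img: "?lab ` G \<subseteq> V \<rightarrow>\<^sub>E H"
    using G W_D(4) V_words by (auto simp: subset_iff)
  have fin: "finite (V \<rightarrow>\<^sub>E H)" using V finite_H by (auto intro: finite_PiE)
  have "card (actions n G) \<le> card (?lab ` G)"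
    using sub finite_subset[OF img fin] by (meson card_image_le card_mono finite_imageI le_trans)
  also have "\<dots> \<le> card (V \<rightarrow>\<^sub>E H)" using img fin by (rule card_mono[rotated])
  finally show ?thesis by (simp add: card_PiE[OF V])
qed

section \<open>Pairs of vertices with adjustable labels\<close>

text \<open>
  The label at \<open>q\<close> can be prescribed at the cost of an uncontrolled label at \<open>r\<close>.
\<close>

definition adjustable :: "(nat list \<Rightarrow> nat list) set \<Rightarrow> nat \<Rightarrow> nat list \<Rightarrow> nat list \<Rightarrow> bool"
  where "adjustable G n q r \<longleftrightarrow> (\<forall>h\<in>H. \<exists>z\<in>G. (\<forall>w\<in>level m n. z w = w) \<and> label z q = h \<and>
    (\<forall>v\<in>level m n - {q, r}. label z v = id))"

definition linked :: "(nat list \<Rightarrow> nat list) set \<Rightarrow> nat \<Rightarrow> nat list \<Rightarrow> nat list \<Rightarrow> bool"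
  where "linked G n q r \<longleftrightarrow> q = r \<or> adjustable G n q r \<and> adjustable G n r q"

text \<open>
  The uncontrolled label at \<open>r\<close> is cancelled by a second element, which moves the defect to \<open>s\<close>.
\<close>

lemma adjustable_trans:
  assumes G: "subgroup G (wreath m H)"
    and qrs: "q \<in> level m n" "r \<in> level m n" "q \<noteq> r" "q \<noteq> s"
    and adj: "adjustable G n q r" "adjustable G n r s"
  shows "adjustable G n q s"
  unfolding adjustable_def
proof
  note GD = subgroup_W_D[OF G]
  fix h assume "h \<in> H"
  then obtain z where z: "z \<in> G" "\<forall>w\<in>level m n. z w = w" "label z q = h"
    "\<forall>v\<in>level m n - {q, r}. label z v = id" using adj(1) unfolding adjustable_def by blast
  have r: "label z r \<in> H" using W_D(4)[OF GD(5)[OF z(1)]] qrs by (simp add: level_def)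
  then obtain y where y: "y \<in> G" "\<forall>w\<in>level m n. y w = w" "label y r = Hilbert_Choice.inv (label z r)"
    "\<forall>v\<in>level m n - {r, s}. label y v = id" using adj(2) H_inv[OF r] unfolding adjustable_def by blast
  have lab: "label (z \<circ> y) v = label z v \<circ> label y v" if "v \<in> level m n" for v
    using label_comp[of z y v] GD(5) z y that by (auto simp: level_def)
  have "label (z \<circ> y) r = id"
    using lab[OF qrs(2)] y(3) permutes_inv_o(1)[OF H_permutes[OF r]] by simp
  then have "label (z \<circ> y) v = id" if "v \<in> level m n - {q, s}" for v
    using lab[of v] z(4) y(4) that by (cases "v = r") auto
  moreover have "label (z \<circ> y) q = h" using lab[OF qrs(1)] z(3) y(4) qrs by auto
  ultimately show "\<exists>z\<in>G. (\<forall>w\<in>level m n. z w = w) \<and> label z q = h \<and> (\<forall>v\<in>level m n - {q, s}. label z v = id)"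
    using z(1,2) y(1,2) GD(3) by (intro bexI[of _ "z \<circ> y"]) auto
qed

lemma adjustable_conj:
  assumes G: "subgroup G (wreath m H)" and s: "s \<in> G" and q: "q \<in> level m n"
    and adj: "adjustable G n q r"
  shows "adjustable G n (s q) (s r)"
  unfolding adjustable_def
proof
  note GD = subgroup_W_D[OF G]
  have sW: "s \<in> W" using GD(5) s .
  fix h assume h: "h \<in> H"
  have l: "label s q \<in> H" using W_D(4)[OF sW] q by (simp add: level_def)
  have "Hilbert_Choice.inv (label s q) \<circ> h \<circ> label s q \<in> H" using l h by simp
  then obtain z where z: "z \<in> G" "\<forall>w\<in>level m n. z w = w"
    "label z q = Hilbert_Choice.inv (label s q) \<circ> h \<circ> label s q"
    "\<forall>v\<in>level m n - {q, r}. label z v = id" using adj unfolding adjustable_def by blast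
  let ?y = "s \<circ> z \<circ> Hilbert_Choice.inv s"
  have lab: "label ?y (s v) = label s v \<circ> label z v \<circ> Hilbert_Choice.inv (label s v)" if "v \<in> level m n" for v
    using label_comp[of "s \<circ> z" "Hilbert_Choice.inv s" "s v"] label_comp[of s z v] label_inv[OF sW, of v]
      GD(5) z sW that by (simp add: level_def)
  have inv: "label s v \<circ> Hilbert_Choice.inv (label s v) = id" if "v \<in> level m n" for v
    using permutes_inv_o(1)[OF H_permutes[OF W_D(4)[OF sW]], of v] that by (simp add: level_def)
  have "label ?y (s q) = (label s q \<circ> Hilbert_Choice.inv (label s q)) \<circ> h \<circ> (label s q \<circ> Hilbert_Choice.inv (label s q))"
    using lab[OF q] z(3) by (simp add: comp_assoc)
  then have "label ?y (s q) = h" using inv[OF q] by simp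
  moreover have "label ?y v = id" if v: "v \<in> level m n - {s q, s r}" for v
  proof -
    obtain v' where v': "v = s v'" "v' \<in> level m n"
      using v sW by (intro that[of "Hilbert_Choice.inv s v"]) auto
    then have "label z v' = id" using z(4) v by auto
    then show ?thesis using lab[OF v'(2)] inv[OF v'(2)] v'(1) by simp
  qed
  moreover have "\<forall>w\<in>level m n. ?y w = w" using z(2) sW by simp
  ultimately show "\<exists>z\<in>G. (\<forall>w\<in>level m n. z w = w) \<and> label z (s q) = h \<and>
      (\<forall>v\<in>level m n - {s q, s r}. label z v = id)"
    using GD(3)[OF GD(3)[OF s z(1)] GD(4)[OF s]] by (intro bexI[of _ ?y] conjI ballI) simp_all
qed

lemma linked_sym: "linked G n q r \<Longrightarrow> linked G n r q"
  by (auto simp: linked_def)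

lemma linked_trans:
  assumes "subgroup G (wreath m H)" "q \<in> level m n" "r \<in> level m n" "s \<in> level m n"
    and "linked G n q r" "linked G n r s"
  shows "linked G n q s"
proof (cases "q = r \<or> r = s \<or> q = s")
  case False
  then show ?thesis
    using assms adjustable_trans[OF assms(1,2,3), of s] adjustable_trans[OF assms(1,4,3), of q]
    by (auto simp: linked_def)
qed (use assms in \<open>auto simp: linked_def\<close>)

lemma linked_conj:
  assumes "subgroup G (wreath m H)" "s \<in> G" "q \<in> level m n" "r \<in> level m n" "linked G n q r"
  shows "linked G n (s q) (s r)"
  using assms adjustable_conj[OF assms(1,2,3), of r] adjustable_conj[OF assms(1,2,4), of q]
  by (auto simp: linked_def)

text \<open>
  One representative of each class of linked vertices absorbs the uncontrolled labels, so that \<open>B\<close>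
  can consist of all other vertices; large classes mean few representatives.
\<close>

lemma linked_representatives:
  assumes G: "subgroup G (wreath m H)" and V: "V \<subseteq> level m n"
    and k: "\<And>v. v \<in> V \<Longrightarrow> k \<le> card {w \<in> V. linked G n v w}"
  shows "\<exists>B\<subseteq>V. k * card (V - B) \<le> card V \<and> (\<forall>q\<in>B. \<exists>r\<in>V - B. adjustable G n q r)"
proof -
  have fin: "finite V" using V finite_level finite_subset by blast
  define cls where "cls v = {w \<in> V. linked G n v w}" for v
  \<comment> \<open>Linked vertices have equal classes, so the choice depends only on the class.\<close>
  define rep where "rep v = (SOME w. w \<in> cls v)" for v
  have self: "v \<in> cls v" if "v \<in> V" for v using that by (simp add: cls_def linked_def)
  have rep: "rep v \<in> V" "linked G n v (rep v)" if "v \<in> V" for v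
    using someI[of "\<lambda>w. w \<in> cls v", OF self[OF that]] by (auto simp: rep_def cls_def)
  have cls_eq: "cls v = cls w" if "v \<in> V" "w \<in> cls v" for v w
    using that linked_trans[OF G] linked_sym V unfolding cls_def by blast
  let ?B = "V - rep ` V"
  have R: "V - ?B = rep ` V" using rep by blast
  have "k * card (rep ` V) = (\<Sum>r\<in>rep ` V. k)" by simp
  also have "\<dots> \<le> (\<Sum>r\<in>rep ` V. card {v \<in> V. rep v = r})"
  proof (rule sum_mono)
    fix r assume "r \<in> rep ` V"
    then obtain v where v: "v \<in> V" "r = rep v" by blast
    have "cls v \<subseteq> {w \<in> V. rep w = r}"
      using cls_eq[OF v(1)] v(2) by (auto simp: rep_def) (simp add: cls_def)
    then have "card (cls v) \<le> card {w \<in> V. rep w = r}" using fin by (intro card_mono) auto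
    then show "k \<le> card {w \<in> V. rep w = r}" using k[OF v(1)] by (simp add: cls_def)
  qed
  also have "\<dots> = card V"
    using sum.image_gen[OF fin, of "\<lambda>_. 1::nat" rep] by simp
  finally have "k * card (V - ?B) \<le> card V" using R by simp
  moreover have "\<exists>r\<in>V - ?B. adjustable G n q r" if "q \<in> ?B" for q
  proof -
    have "rep q \<noteq> q" using that by force
    then have "adjustable G n q (rep q)" using rep(2)[of q] that by (auto simp: linked_def)
    then show ?thesis using that R by blast
  qed
  ultimately show ?thesis by blast
qed

end

section \<open>The finitely generated subgroups\<close>

text \<open>
  A prefix code for pairs of numbers. The letter 2 occurs only at even positions, which makes
  different code words fork evenly; the letter 1 after it keeps the next position even.
\<close>

definition code :: "nat \<Rightarrow> nat \<Rightarrow> nat list"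
  where "code a b = replicate (2 * a) 1 @ [2, 1] @ replicate (2 * b) 1 @ [2, 1]"

text \<open>
  The address must determine \<open>c\<close> and \<open>N\<close>, but for fixed \<open>c\<close> it must stay much shorter than \<open>N\<close>.
  A code word for \<open>N\<close> itself would have length about \<open>2 * N\<close>; division by 4 brings this down to
  about \<open>N / 2\<close>, and the remainder modulo 4 goes into the bounded part.
\<close>

definition address :: "nat list \<Rightarrow> nat \<Rightarrow> nat list"
  where "address c N = code (4 * to_nat c + N mod 4) (N div 4)"

lemma forks_evenly_sym:
  assumes "forks_evenly u w" shows "forks_evenly w u"
proof -
  obtain l where "even l" "l < length u" "l < length w" "take l u = take l w" "u ! l \<noteq> w ! l"
    using assms unfolding forks_evenly_def by blast
  then show ?thesis unfolding forks_evenly_def by (intro exI[of _ l]) simp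
qed

lemma forks_evenlyI: "even (length p) \<Longrightarrow> x \<noteq> y \<Longrightarrow> forks_evenly (p @ x # v) (p @ y # w)"
  unfolding forks_evenly_def by (intro exI[of _ "length p"]) simp

lemma length_code: "length (code a b) = 2 * a + 2 * b + 4"
  by (simp add: code_def)

lemma code_forks_less:
  assumes "a < a' \<or> a = a' \<and> b < b'"
  shows "forks_evenly (code a b) (code a' b' @ w)"
proof -
  have split: "replicate (2 * l) 1 = replicate (2 * k) 1 @ 1 # replicate (2 * l - 2 * k - 1) (1::nat)"
    if "k < l" for k l
    using that by (simp flip: replicate_add replicate_Suc)
  show ?thesis using assms
  proof
    assume "a < a'"
    then show ?thesis
      unfolding code_def split[OF \<open>a < a'\<close>]
      using forks_evenlyI[of "replicate (2 * a) 1" 2 1] by simp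
  next
    assume b: "a = a' \<and> b < b'"
    let ?p = "replicate (2 * a) 1 @ [2, 1] @ replicate (2 * b) (1::nat)"
    have "code a b = ?p @ 2 # [1]" by (simp add: code_def)
    moreover have "code a' b' @ w = ?p @ 1 # (replicate (2 * b' - 2 * b - 1) 1 @ [2, 1] @ w)"
      using b split[of b b'] by (simp add: code_def)
    moreover have "even (length ?p)" by simp
    ultimately show ?thesis using forks_evenlyI[of ?p 2 1] by (simp only:)
  qed
qed

lemma forks_evenly_append: "forks_evenly u w \<Longrightarrow> forks_evenly u (w @ w')"
  by (auto simp: forks_evenly_def nth_append)

lemma code_forks:
  assumes "(a, b) \<noteq> (a', b')"
  shows "forks_evenly (code a b) (code a' b' @ w)"
proof -
  consider "a < a' \<or> a = a' \<and> b < b'" | "a' < a \<or> a' = a \<and> b' < b"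
    using assms by fastforce
  then show ?thesis
  proof cases
    case 2
    then have "forks_evenly (code a' b') (code a b)" using code_forks_less[of a' a b' b "[]"] by auto
    then show ?thesis using forks_evenly_sym forks_evenly_append by blast
  qed (rule code_forks_less)
qed

lemma address_forks:
  assumes "(c, N) \<noteq> (c', N')"
  shows "forks_evenly (address c N) (address c' N' @ w)"
proof -
  have "c = c' \<and> N = N'"
    if "4 * to_nat c + N mod 4 = 4 * to_nat c' + N' mod 4" "N div 4 = N' div 4"
  proof -
    have c: "to_nat c = to_nat c'" using arg_cong[OF that(1), of "\<lambda>x. x div 4"] by simp
    moreover have "N mod 4 = N' mod 4" using that(1) c by simp
    then have "N = N'" using that(2) by (metis div_mult_mod_eq)
    ultimately show ?thesis by simp
  qed
  then show ?thesis
    unfolding address_def using assms by (intro code_forks) auto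
qed

lemma even_length_address: "even (length (address c N))"
  by (simp add: address_def length_code)

lemma length_addressess_le: "length (address c N) \<le> 8 * to_nat c + 10 + N div 4 * 2"
  using mod_less_divisor[of 4 N] by (simp add: address_def length_code)

lemma forks_evenly_not_prefix:
  assumes "forks_evenly u w" shows "\<not> prefix (u @ x) (w @ y)"
proof
  assume p: "prefix (u @ x) (w @ y)"
  obtain l where l: "l < length u" "l < length w" "u ! l \<noteq> w ! l"
    using assms by (auto simp: forks_evenly_def)
  have "(w @ y) ! l = (u @ x) ! l" by (rule nth_prefix[OF p]) (use l in simp)
  then show False using l by (simp add: nth_append)
qed

locale spread = transitive_wreath_product +
  fixes C :: "nat list set"
  assumes C: "prefix_free C" "C \<subseteq> tree_words m"
begin

text \<open>
  The pivot is an arbitrary vertex on level \<open>N\<close> below the address.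
\<close>

definition "pivot c N = address c N @ replicate (N - length (address c N)) 1"

definition "pivots = {c @ pivot c N | c N. c \<in> C \<and> length (address c N) \<le> N}"

lemma address_words: "address c N \<in> tree_words m"
  using m2 by (auto simp: address_def code_def tree_words_def)

lemma pivot_level: "length (address c N) \<le> N \<Longrightarrow> pivot c N \<in> level m N"
  using address_words[of c N] m2 by (auto simp: pivot_def level_def tree_words_def)

lemma pivots_words: "pivots \<subseteq> tree_words m"
  using pivot_level C(2) by (auto simp: pivots_def level_def tree_words_append)

lemma pivots_unique:
  assumes "c \<in> C" "c' \<in> C" "prefix (c @ pivot c N @ w) (c' @ pivot c' N' @ w')"
  shows "c = c' \<and> N = N'"
proof -
  have "prefix c (c' @ pivot c' N' @ w')" "prefix c' (c' @ pivot c' N' @ w')"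
    using assms(3) by (auto dest: append_prefixD)
  then have c: "c = c'" using prefix_free_unique[OF C(1) assms(1,2)] by blast
  have "prefix (address c N @ replicate (N - length (address c N)) 1 @ w)
    (address c' N' @ replicate (N' - length (address c' N')) 1 @ w')"
    using assms(3) c by (simp add: pivot_def)
  then show ?thesis
    using forks_evenly_not_prefix address_forks[of c N c' N' "[]"] by auto
qed

lemma prefix_free_pivots: "prefix_free pivots"
proof -
  have "c @ pivot c N = c' @ pivot c' N'"
    if "c \<in> C" "c' \<in> C" "prefix (c @ pivot c N) (c' @ pivot c' N')" for c c' N N'
    using pivots_unique[of c c' N "[]" N' "[]"] that by auto
  then show ?thesis unfolding prefix_free_def pivots_def by blast
qed

definition "spread_gens =
  graft C ` (root_perm m ` H \<union> mark (spurs {j. even j}) ` H \<union> mark (spurs {j. odd j}) ` H) \<union>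
  mark pivots ` H"

lemma spread_gens_W: "spread_gens \<subseteq> W"
  using spinal_gens_W graft_W(1)[OF C] mark_W[OF prefix_free_pivots pivots_words]
  unfolding spread_gens_def by blast

lemma spread_gens_finite: "finite spread_gens" "card spread_gens \<le> 4 * card H"
proof -
  show "finite spread_gens" unfolding spread_gens_def using finite_H by blast
  have *: "card (A \<union> B) \<le> card A + card B" for A B :: "(nat list \<Rightarrow> nat list) set"
    by (rule card_Un_le)
  have i: "card (f ` H) \<le> card H" for f :: "_ \<Rightarrow> nat list \<Rightarrow> nat list"
    by (rule card_image_le[OF finite_H])
  have "card spread_gens \<le> card (graft C ` root_perm m ` H) + card (graft C ` mark (spurs {j. even j}) ` H) +
    card (graft C ` mark (spurs {j. odd j}) ` H) + card (mark pivots ` H)"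
    unfolding spread_gens_def image_Un by (meson * add_le_mono le_trans order_refl)
  also have "\<dots> \<le> card H + card H + card H + card H"
    unfolding image_image by (intro add_mono i)
  finally show "card spread_gens \<le> 4 * card H" by simp
qed

definition "spread_group = generate (wreath m H) spread_gens"

lemma spread_subgroup: "subgroup spread_group (wreath m H)"
  unfolding spread_group_def by (rule generate_W(1)[OF spread_gens_W])

lemmas spread_D = subgroup_W_D[OF spread_subgroup]

lemma spread_gens_subset: "spread_gens \<subseteq> spread_group"
  unfolding spread_group_def by (rule generate_W(2)[OF spread_gens_W])

lemma graft_spinal: "g \<in> spinal \<Longrightarrow> graft C g \<in> spread_group"
proof -
  assume g: "g \<in> spinal"
  show ?thesis
  proof (rule generate_W_induct[OF spinal_gens_W, of g "\<lambda>g. graft C g \<in> spread_group"])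
    show "g \<in> generate (wreath m H)
      (root_perm m ` H \<union> mark (spurs {j. even j}) ` H \<union> mark (spurs {j. odd j}) ` H)"
      using g by (simp add: spinal_def)
    show "graft C id \<in> spread_group" using spread_D(2) graft_id[OF C(1)] by simp
    fix s assume s: "s \<in> root_perm m ` H \<union> mark (spurs {j. even j}) ` H \<union> mark (spurs {j. odd j}) ` H"
    then show "graft C s \<in> spread_group"
      using spread_gens_subset unfolding spread_gens_def by blast
    then show "graft C (Hilbert_Choice.inv s) \<in> spread_group"
      using spread_D(4) graft_inv[OF C subsetD[OF spinal_gens_W s]] by metis
  next
    fix a b assume "graft C a \<in> spread_group" "graft C b \<in> spread_group"
    then show "graft C (a \<circ> b) \<in> spread_group"
      using spread_D(3) graft_comp[OF C(1)] by metis
  qed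
qed

text \<open>
  Let \<open>T\<close> be \<open>t\<close> performed below every word in \<open>C\<close>, and let \<open>x = xi \<circ> y\<close> where \<open>xi\<close> carries the
  label of \<open>x = mark pivots h\<close> at the pivot \<open>p\<close> and \<open>y\<close> all the others. Then \<open>T\<close> commutes with
  \<open>y\<close>, so the commutator of \<open>x\<close> and \<open>T\<close> equals that of \<open>xi\<close> and \<open>T\<close>. It has the label \<open>h\<close> at
  \<open>p\<close>, a conjugate of the inverse of \<open>h\<close> at \<open>T p\<close>, and no other label on this level. As \<open>h\<close> runs
  through \<open>H\<close>, so does each of the two labels.
\<close>

lemma linked_pivot:
  assumes c: "c \<in> C" and N: "length (address c N) \<le> N" and t: "t \<in> side_group (address c N)"
  shows "linked spread_group (length c + N) (c @ pivot c N) (c @ t (pivot c N))"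
proof (cases "t (pivot c N) = pivot c N")
  case False
  let ?n = "length c + N"
  let ?u = "address c N"
  let ?p = "c @ pivot c N"
  define T where "T = graft C t"
  have tW: "t \<in> W" using t side_group_D by blast
  have T: "T \<in> spread_group" using graft_spinal side_group_spinal t by (auto simp: T_def)
  have TW: "T \<in> W" using T spread_D by blast
  have Tbelow: "T (c' @ w) = c' @ t w" if "c' \<in> C" for c' w
    using graft_below[OF C(1) that] by (simp add: T_def)
  have p: "?p \<in> pivots" "?p \<in> level m ?n" "?p \<in> tree_words m"
    using c N pivot_level[OF N] C(2) by (auto simp: pivots_def level_def tree_words_append)
  have "T ?p = c @ t (pivot c N)" by (rule Tbelow[OF c])
  moreover have "T ?p \<in> level m ?n" using W_level[OF TW] p(2) by blast
  ultimately have Tp: "T ?p = c @ t (pivot c N)" "T ?p \<in> level m ?n" "T ?p \<noteq> ?p"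
    using False by simp_all
  have single: "{?p} \<subseteq> tree_words m" using p by simp
  have pf: "prefix_free (pivots - {?p})" using prefix_free_pivots by (rule prefix_free_subset) blast
  have fix_other: "T (q @ w) = q @ w" if q: "q \<in> pivots - {?p}" for q w
  proof -
    obtain c' N' where q': "q = c' @ pivot c' N'" "c' \<in> C" using q by (auto simp: pivots_def)
    then have ne: "(c, N) \<noteq> (c', N')" using q by auto
    have "t (pivot c' N' @ w) = pivot c' N' @ w"
    proof (cases "pivot c' N' @ w \<in> tree_words m")
      case True
      then show ?thesis
        using side_group_fixes_forks[OF t address_words True] address_forks[OF ne] by (simp add: pivot_def)
    qed (rule W_outside[OF tW])
    then show ?thesis using q' Tbelow by simp
  qed
  define lam where "lam = label T ?p"
  have lam: "lam \<in> H" using W_D(4)[OF TW p(3)] by (simp add: lam_def)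
  have comm: "\<exists>z\<in>spread_group. (\<forall>w\<in>level m ?n. z w = w) \<and> label z ?p = h \<and>
      label z (T ?p) = lam \<circ> Hilbert_Choice.inv h \<circ> Hilbert_Choice.inv lam \<and>
      (\<forall>v\<in>level m ?n - {?p, T ?p}. label z v = id)" if h: "h \<in> H" for h
  proof -
    define x where "x = mark pivots h"
    define y where "y = mark (pivots - {?p}) h"
    define xi where "xi = mark {?p} h"
    have xW: "x \<in> W" and xiW: "xi \<in> W"
      using mark_W[OF prefix_free_pivots pivots_words h] mark_W[OF _ single h] by (auto simp: x_def xi_def)
    have yW: "y \<in> W" unfolding y_def by (rule mark_W[OF pf _ h]) (use pivots_words in blast)
    have x: "x = xi \<circ> y"
      unfolding x_def y_def xi_def by (rule graft_split[OF prefix_free_pivots p(1)])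
    have Ty: "T \<circ> y = y \<circ> T"
      unfolding y_def using fix_other permutes_inj[OF W_D(1)[OF TW]] by (intro graft_commute[OF pf]) auto
    let ?z = "x \<circ> T \<circ> Hilbert_Choice.inv x \<circ> Hilbert_Choice.inv T"
    let ?z' = "xi \<circ> T \<circ> Hilbert_Choice.inv xi \<circ> Hilbert_Choice.inv T"
    have "x \<in> spread_group" using spread_gens_subset h by (auto simp: spread_gens_def x_def)
    then have z: "?z \<in> spread_group" using spread_D(3,4) T by simp
    have "x \<circ> T \<circ> Hilbert_Choice.inv x = xi \<circ> T \<circ> Hilbert_Choice.inv xi"
    proof -
      have "xi \<circ> T \<circ> Hilbert_Choice.inv xi \<circ> x = xi \<circ> (T \<circ> y)"
        using x xiW by (simp add: fun_eq_iff)
      also have "\<dots> = x \<circ> T" using x Ty by (simp add: comp_assoc)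
      finally have "xi \<circ> T \<circ> Hilbert_Choice.inv xi \<circ> (x \<circ> Hilbert_Choice.inv x) = x \<circ> T \<circ> Hilbert_Choice.inv x"
        by (metis comp_assoc)
      then show ?thesis using xW by (simp add: comp_assoc)
    qed
    then have zz: "?z = ?z'" by simp
    \<comment> \<open>The only label of \<open>xi\<close> is on level \<open>?n\<close> and acts on the next one.\<close>
    have xifix: "xi w = w" if "w \<in> level m ?n" for w
      unfolding xi_def
      by (rule mark_fixes_above[OF _ single h])
        (use that p(2) in \<open>auto simp: level_def dest: prefix_length_less\<close>)
    have xiinv: "Hilbert_Choice.inv xi w = w" if "w \<in> level m ?n" for w
      using xifix[OF that] W_inverse(2)[OF xiW, of w] by simp
    have labxi: "label xi v = (if v = ?p then h else id)" if "v \<in> level m ?n" for v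
      using label_mark[OF _ single h, of v] that by (simp add: xi_def level_def)
    have labxi': "label (Hilbert_Choice.inv xi) v = (if v = ?p then Hilbert_Choice.inv h else id)"
      if "v \<in> level m ?n" for v
      using label_inv[OF xiW, of v] labxi[OF that] xifix[OF that] that by (auto simp: level_def)
    have lab: "label ?z (T v) = label xi (T v) \<circ> label T v \<circ> label (Hilbert_Choice.inv xi) v \<circ>
        Hilbert_Choice.inv (label T v)" if v: "v \<in> level m ?n" for v
    proof -
      have w: "v \<in> tree_words m" "T v \<in> tree_words m" using v TW by (auto simp: level_def)
      have i: "Hilbert_Choice.inv T (T v) = v" using TW by simp
      have a: "label (Hilbert_Choice.inv T) (T v) = Hilbert_Choice.inv (label T v)"
        by (rule label_inv[OF TW w(1)])
      have b: "label ?z' (T v) = label (xi \<circ> T \<circ> Hilbert_Choice.inv xi) v \<circ> label (Hilbert_Choice.inv T) (T v)"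
        using label_comp[of "xi \<circ> T \<circ> Hilbert_Choice.inv xi" "Hilbert_Choice.inv T" "T v"] xiW TW w(2) i by simp
      have d: "label (xi \<circ> T \<circ> Hilbert_Choice.inv xi) v = label (xi \<circ> T) v \<circ> label (Hilbert_Choice.inv xi) v"
        using label_comp[of "xi \<circ> T" "Hilbert_Choice.inv xi" v] xiW TW w(1) xiinv[OF v] by simp
      have e: "label (xi \<circ> T) v = label xi (T v) \<circ> label T v"
        by (rule label_comp[OF xiW TW w(1)])
      show ?thesis unfolding zz b d e a ..
    qed
    have inv: "label T v \<circ> Hilbert_Choice.inv (label T v) = id" if "v \<in> level m ?n" for v
      using permutes_inv_o(1)[OF H_permutes[OF W_D(4)[OF TW]], of v] that by (simp add: level_def)
    have "label ?z (T ?p) = lam \<circ> Hilbert_Choice.inv h \<circ> Hilbert_Choice.inv lam"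
      using lab[OF p(2)] labxi[OF Tp(2)] labxi'[OF p(2)] Tp(3) by (simp add: lam_def)
    moreover have other: "label ?z v = label xi v" if v: "v \<in> level m ?n" "v \<noteq> T ?p" for v
    proof -
      obtain v' where v': "v = T v'" "v' \<in> level m ?n"
        using v TW by (intro that[of "Hilbert_Choice.inv T v"]) auto
      then have "v' \<noteq> ?p" using v(2) by auto
      then show ?thesis using lab[OF v'(2)] labxi'[OF v'(2)] inv[OF v'(2)] v'(1)
        by (simp add: comp_assoc)
    qed
    moreover have "label ?z ?p = h" using other[OF p(2)] Tp(3) labxi[OF p(2)] by auto
    moreover have "label ?z v = id" if "v \<in> level m ?n - {?p, T ?p}" for v
      using that other[of v] labxi[of v] by auto
    moreover have "?z w = w" if "w \<in> level m ?n" for w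
    proof -
      have "Hilbert_Choice.inv xi (Hilbert_Choice.inv T w) = Hilbert_Choice.inv T w"
        using xiinv that TW by simp
      then show ?thesis unfolding zz using that TW xifix by simp
    qed
    ultimately show ?thesis using z by blast
  qed
  have "adjustable spread_group ?n ?p (T ?p)"
    unfolding adjustable_def using comm by blast
  moreover have "adjustable spread_group ?n (T ?p) ?p"
    unfolding adjustable_def
  proof
    fix k assume k: "k \<in> H"
    have bij: "bij lam" "bij k" using H_permutes lam k permutes_bij by blast+
    define h where "h = Hilbert_Choice.inv lam \<circ> Hilbert_Choice.inv k \<circ> lam"
    have "Hilbert_Choice.inv h = Hilbert_Choice.inv lam \<circ> k \<circ> lam"
      using bij by (simp add: h_def o_inv_distrib bij_comp bij_imp_bij_inv inv_inv_eq comp_assoc)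
    then have eq: "lam \<circ> Hilbert_Choice.inv h \<circ> Hilbert_Choice.inv lam = k"
      using permutes_inv_o(1)[OF H_permutes[OF lam]] by (simp add: fun_eq_iff)
    have "h \<in> H" using lam k by (simp add: h_def)
    from comm[OF this] show "\<exists>z\<in>spread_group. (\<forall>w\<in>level m ?n. z w = w) \<and> label z (T ?p) = k \<and>
        (\<forall>v\<in>level m ?n - {T ?p, ?p}. label z v = id)"
      unfolding eq insert_commute[of "T ?p" ?p] by blast
  qed
  ultimately show ?thesis by (simp add: linked_def Tp(1))
qed (simp add: linked_def)

text \<open>
  The number of even levels strictly between the address and the pivot. By truncation it is 0 when
  the address is too long for level \<open>N\<close>; the bounds below then claim nothing.
\<close>

definition "branchings c N = (N - length (address c N) - 1) div 2"

text \<open>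
  The spinal group carries the pivot to every vertex \<open>c @ q\<close> on its level, and linked pairs to
  linked pairs.
\<close>

lemma linked_class_card:
  assumes c: "c \<in> C" and v: "v \<in> (@) c ` level m N"
  shows "m ^ branchings c N \<le> card {w \<in> (@) c ` level m N. linked spread_group (length c + N) v w}"
    (is "_ \<le> card ?K")
proof -
  have fin: "finite ?K" by simp
  show ?thesis
  proof (cases "length (address c N) \<le> N")
    case False
    have "v \<in> ?K" using v by (simp add: linked_def)
    then have "card ?K > 0" using fin card_gt_0_iff by blast
    then show ?thesis using False by (simp add: branchings_def)
  next
    case True
    let ?p = "pivot c N"
    obtain q where q: "v = c @ q" "q \<in> level m N" using v by blast
    obtain s where s: "s \<in> spinal" "s ?p = q" using spinal_transitive2[OF pivot_level[OF True] q(2)] by blast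
    have sW: "s \<in> W" using s spinal_D by blast
    have S: "graft C s \<in> spread_group" by (rule graft_spinal[OF s(1)])
    have lev: "c @ w \<in> level m (length c + N)" if "w \<in> level m N" for w
      using that c C(2) by (auto simp: level_def tree_words_append)
    let ?O = "(\<lambda>t. t ?p) ` side_group (address c N)"
    have "(\<lambda>r. c @ s r) ` ?O \<subseteq> ?K"
    proof (rule image_subsetI)
      fix r assume "r \<in> ?O"
      then obtain t where t: "t \<in> side_group (address c N)" and r: "r = t ?p" by blast
      have tW: "t \<in> W" using t side_group_D by blast
      have tp: "t ?p \<in> level m N" using tW pivot_level[OF True] by simp
      have "linked spread_group (length c + N) (graft C s (c @ ?p)) (graft C s (c @ t ?p))"
        by (rule linked_conj[OF spread_subgroup S lev[OF pivot_level[OF True]] lev[OF tp] linked_pivot[OF c True t]])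
      then have "linked spread_group (length c + N) v (c @ s (t ?p))"
        using graft_below[OF C(1) c] s(2) q(1) by simp
      then show "c @ s r \<in> ?K" using tp sW r by simp
    qed
    then have "card ((\<lambda>r. c @ s r) ` ?O) \<le> card ?K" by (rule card_mono[OF fin])
    moreover have "card ((\<lambda>r. c @ s r) ` ?O) = card ?O"
      by (rule card_image) (use sW in \<open>auto simp: inj_on_def\<close>)
    moreover have "m ^ branchings c N \<le> card ?O"
      unfolding branchings_def
      by (rule side_group_orbit[OF even_length_address _ pivot_level[OF True]]) (simp add: pivot_def)
    ultimately show ?thesis by linarith
  qed
qed

lemma card_words_below: "card ((@) c ` level m k) = m ^ k"
  by (subst card_image) (auto simp: card_level inj_on_def)

lemma finite_short: "finite {c \<in> C. length c \<le> n}"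
proof (rule finite_subset)
  show "{c \<in> C. length c \<le> n} \<subseteq> (\<Union>k\<le>n. level m k)" using C(2) by (auto simp: level_def)
qed simp

text \<open>
  Below \<open>c\<close> at most a fraction \<open>1 / m ^ branchings c (n - length c)\<close> of the labels on level \<open>n\<close> is
  lost.
\<close>

lemma spread_layer:
  "\<exists>b. card (actions n spread_group) * card H ^ b \<le> card (actions (Suc n) spread_group) \<and>
    (\<Sum>c\<in>{c \<in> C. length c \<le> n}. real m ^ (n - length c) * (1 - 1 / real m ^ branchings c (n - length c))) \<le> real b"
proof -
  let ?C = "{c \<in> C. length c \<le> n}"
  define V where "V c = (@) c ` level m (n - length c)" for c
  have V: "V c \<subseteq> level m n" if "c \<in> ?C" for c
    using that C(2) by (auto simp: V_def level_def tree_words_append)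
  have disj: "c = c'" if "c \<in> ?C" "c' \<in> ?C" "w \<in> V c" "w \<in> V c'" for c c' w
  proof -
    have "prefix c w" "prefix c' w" using that(3,4) by (force simp: V_def prefix_def)+
    then show ?thesis using prefix_free_unique[OF C(1), of c c' w] that by simp
  qed
  have "\<forall>c\<in>?C. \<exists>B. B \<subseteq> V c \<and> m ^ branchings c (n - length c) * card (V c - B) \<le> card (V c) \<and>
      (\<forall>q\<in>B. \<exists>r\<in>V c - B. adjustable spread_group n q r)"
  proof
    fix c assume c: "c \<in> ?C"
    show "\<exists>B. B \<subseteq> V c \<and> m ^ branchings c (n - length c) * card (V c - B) \<le> card (V c) \<and>
      (\<forall>q\<in>B. \<exists>r\<in>V c - B. adjustable spread_group n q r)"
    proof (rule linked_representatives[OF spread_subgroup V[OF c]])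
      fix v assume "v \<in> V c"
      then show "m ^ branchings c (n - length c) \<le> card {w \<in> V c. linked spread_group n v w}"
        using linked_class_card[of c v "n - length c"] c by (simp add: V_def)
    qed
  qed
  from bchoice[OF this] obtain B where B0: "\<forall>c\<in>?C. B c \<subseteq> V c \<and>
    m ^ branchings c (n - length c) * card (V c - B c) \<le> card (V c) \<and>
    (\<forall>q\<in>B c. \<exists>r\<in>V c - B c. adjustable spread_group n q r)" ..
  have B: "\<And>c. c \<in> ?C \<Longrightarrow> B c \<subseteq> V c"
    "\<And>c. c \<in> ?C \<Longrightarrow> m ^ branchings c (n - length c) * card (V c - B c) \<le> card (V c)"
    "\<And>c q. c \<in> ?C \<Longrightarrow> q \<in> B c \<Longrightarrow> \<exists>r\<in>V c - B c. adjustable spread_group n q r"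
    using B0 by auto
  have finV: "finite (V c)" for c by (simp add: V_def)
  let ?B = "\<Union>c\<in>?C. B c"
  have "card (actions n spread_group) * card H ^ card ?B \<le> card (actions (Suc n) spread_group)"
  proof (rule layer_growth[OF spread_subgroup])
    show "?B \<subseteq> level m n" using B(1) V by blast
    fix q h assume "q \<in> ?B" and h: "h \<in> H"
    then obtain c where c: "c \<in> ?C" "q \<in> B c" by blast
    then obtain r where r: "r \<in> V c - B c" "adjustable spread_group n q r" using B(3) by blast
    have rB: "r \<notin> ?B" using r(1) c disj B(1) by blast
    obtain z where z: "z \<in> spread_group" "\<forall>w\<in>level m n. z w = w" "label z q = h"
      and other: "\<forall>v\<in>level m n - {q, r}. label z v = id"
      using r(2) h unfolding adjustable_def by blast
    have "\<forall>v\<in>?B - {q}. label z v = id"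
    proof
      fix v assume v: "v \<in> ?B - {q}"
      then have "v \<noteq> r" using rB by blast
      moreover have "v \<in> level m n" using v \<open>?B \<subseteq> level m n\<close> by blast
      ultimately show "label z v = id" using v other by blast
    qed
    then show "\<exists>z\<in>spread_group. (\<forall>w\<in>level m n. z w = w) \<and> label z q = h \<and> (\<forall>v\<in>?B - {q}. label z v = id)"
      using z by (intro bexI[of _ z] conjI)
  qed
  moreover have "(\<Sum>c\<in>?C. real m ^ (n - length c) * (1 - 1 / real m ^ branchings c (n - length c))) \<le> real (card ?B)"
  proof -
    have "card ?B = (\<Sum>c\<in>?C. card (B c))"
    proof (rule card_UN_disjoint[OF finite_short])
      show "\<forall>i\<in>?C. finite (B i)" using B(1) finV finite_subset by metis
      show "\<forall>i\<in>?C. \<forall>j\<in>?C. i \<noteq> j \<longrightarrow> B i \<inter> B j = {}" using B(1) disj by blast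
    qed
    moreover have "real m ^ (n - length c) * (1 - 1 / real m ^ branchings c (n - length c)) \<le> real (card (B c))"
      if c: "c \<in> ?C" for c
    proof -
      let ?M = "real m ^ branchings c (n - length c)"
      have M: "?M > 0" using m2 by simp
      have cV: "card (V c) = m ^ (n - length c)"
        unfolding V_def by (rule card_words_below)
      have "card (V c - B c) = card (V c) - card (B c)" "card (B c) \<le> card (V c)"
        using B(1)[OF c] finV finite_subset card_mono card_Diff_subset by metis+
      then have "real (card (V c - B c)) = real m ^ (n - length c) - real (card (B c))"
        using cV by (simp add: of_nat_diff)
      moreover have "?M * real (card (V c - B c)) \<le> real m ^ (n - length c)"
        using of_nat_mono[OF B(2)[OF c], where ?'a = real] cV by simp
      then have "real (card (V c - B c)) \<le> real m ^ (n - length c) / ?M"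
        using M by (simp add: pos_le_divide_eq mult.commute)
      ultimately show ?thesis by (simp add: right_diff_distrib)
    qed
    ultimately show ?thesis by (simp only: of_nat_sum) (rule sum_mono)
  qed
  ultimately show ?thesis by blast
qed

text \<open>
  A word has to pass through an element of \<open>C\<close> before its last letter in order to be moved.
\<close>

lemma spread_fixes:
  assumes "g \<in> spread_group" "v = [] \<or> \<not> (\<exists>c\<in>C. prefix c (butlast v))"
  shows "g v = v"
proof -
  have gen: "s v = v" if s: "s \<in> spread_gens" for s
  proof -
    have cfix: "graft C f v = v" if f: "f \<in> W" for f
    proof (cases v rule: graft_cases[of C])
      case (1 c w)
      then have "w = []" using assms(2) by (cases w rule: rev_cases) (auto simp: butlast_append)
      then show ?thesis using 1 graft_below[OF C(1) 1(1), of f "[]"] W_D(2)[OF f] by simp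
    qed (rule graft_outside)
    have "mark pivots h v = v" if h: "h \<in> H" for h
    proof (rule mark_fixes_above[OF prefix_free_pivots pivots_words h])
      show "\<not> (\<exists>p\<in>pivots. strict_prefix p v)"
      proof
        assume "\<exists>p\<in>pivots. strict_prefix p v"
        then obtain c w where c: "c \<in> C" "strict_prefix (c @ w) v"
          by (auto simp: pivots_def)
        obtain x y where "v = (c @ w) @ x # y" using c(2) by (rule strict_prefixE')
        then have "v \<noteq> []" "prefix c (butlast v)" by (auto simp: butlast_append)
        then show False using assms(2) c(1) by blast
      qed
    qed
    then show ?thesis using s cfix spinal_gens_W unfolding spread_gens_def by blast
  qed
  show ?thesis
  proof (rule generate_W_induct[OF spread_gens_W, of g "\<lambda>g. g v = v"])
    fix s assume s: "s \<in> spread_gens"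
    then have "s v = v" "s \<in> W" using gen spread_gens_W by auto
    then show "Hilbert_Choice.inv s v = v" using W_inverse(2)[of s v] by simp
  qed (use assms(1) gen in \<open>auto simp: spread_group_def\<close>)
qed

lemma spread_upper:
  "card (actions n spread_group) \<le> card H ^ (\<Sum>N<n. \<Sum>c\<in>{c \<in> C. length c \<le> N}. m ^ (N - length c))"
proof -
  define V where "V N = (\<Union>c\<in>{c \<in> C. length c \<le> N}. (@) c ` level m (N - length c))" for N
  have Vl: "V N \<subseteq> level m N" for N
    using C(2) by (auto simp: V_def level_def tree_words_append)
  have "card (V N) = (\<Sum>c\<in>{c \<in> C. length c \<le> N}. card ((@) c ` level m (N - length c)))" for N
    unfolding V_def
  proof (rule card_UN_disjoint[OF finite_short])
    show "\<forall>i\<in>{c \<in> C. length c \<le> N}. \<forall>j\<in>{c \<in> C. length c \<le> N}. i \<noteq> j \<longrightarrow>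
        (@) i ` level m (N - length i) \<inter> (@) j ` level m (N - length j) = {}"
    proof (intro ballI impI)
      fix i j assume ij: "i \<in> {c \<in> C. length c \<le> N}" "j \<in> {c \<in> C. length c \<le> N}" "i \<noteq> j"
      have False if "i @ v = j @ w" for v w
      proof -
        have "prefix i (i @ v)" "prefix j (i @ v)" unfolding prefix_def using that by blast+
        then show False using prefix_free_unique[OF C(1), of i j "i @ v"] ij by simp
      qed
      then show "(@) i ` level m (N - length i) \<inter> (@) j ` level m (N - length j) = {}" by blast
    qed
  qed simp
  then have cV: "card (V N) = (\<Sum>c\<in>{c \<in> C. length c \<le> N}. m ^ (N - length c))" for N
    by (simp add: card_words_below)
  have finV: "finite (V N)" for N using Vl finite_level finite_subset by blast
  have "card (actions n spread_group) \<le> card H ^ card (\<Union>N<n. V N)"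
  proof (rule card_actions_le[OF spread_D(1)])
    show "finite (\<Union>N<n. V N)" using finV by blast
    show "(\<Union>N<n. V N) \<subseteq> tree_words m" using Vl by (auto simp: level_def)
    fix g v assume g: "g \<in> spread_group" and v: "v \<in> tree_words m" "length v < n" "v \<notin> (\<Union>N<n. V N)"
    have out: "\<not> (\<exists>c\<in>C. prefix c v)"
    proof
      assume "\<exists>c\<in>C. prefix c v"
      then obtain c w where c: "c \<in> C" "v = c @ w" by (auto simp: prefix_def)
      then have "v \<in> V (length v)" using v(1) by (auto simp: V_def level_def tree_words_append)
      then show False using v by blast
    qed
    show "label g v = id"
    proof
      fix x show "label g v x = id x"
      proof (cases "x \<in> {1..m}")
        case True
        have "g (v @ [x]) = v @ [x]" by (rule spread_fixes[OF g]) (use out in simp)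
        then show ?thesis by (simp add: tree_label_def)
      qed (auto simp: tree_label_def)
    qed
  qed
  also have "card (\<Union>N<n. V N) = (\<Sum>N<n. card (V N))"
  proof (rule card_UN_disjoint)
    have "length v = N" if "v \<in> V N" for v N using that Vl by (auto simp: level_def)
    then show "\<forall>i\<in>{..<n}. \<forall>j\<in>{..<n}. i \<noteq> j \<longrightarrow> V i \<inter> V j = {}" by blast
  qed (use finV in auto)
  finally show ?thesis by (simp only: cV)
qed

end

section \<open>Two limit lemmas\<close>

text \<open>
  The weights have an unbounded sum, so each initial segment becomes negligible.
\<close>

lemma geometric_average_tendsto:
  fixes r :: "nat \<Rightarrow> real" and m :: nat
  assumes m: "m \<ge> 1" and r: "r \<longlonglongrightarrow> \<alpha>"
  shows "(\<lambda>n. (\<Sum>N<n. real m ^ N * r N) / (\<Sum>N<n. real m ^ N)) \<longlonglongrightarrow> \<alpha>"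
proof (rule LIMSEQ_I)
  fix e :: real assume e: "e > 0"
  let ?D = "\<lambda>n. \<Sum>N<n. real m ^ N"
  obtain M where M: "\<And>N. N \<ge> M \<Longrightarrow> \<bar>r N - \<alpha>\<bar> < e / 2"
    using LIMSEQ_D[OF r, of "e / 2"] e by auto
  define K where "K = (\<Sum>N<M. real m ^ N * \<bar>r N - \<alpha>\<bar>)"
  have D: "real n \<le> ?D n" for n
    using sum_mono[of "{..<n}" "\<lambda>_. 1" "\<lambda>N. real m ^ N"] m by simp
  obtain n0 where n0: "2 * K / e < real n0" using reals_Archimedean2 by blast
  have "norm ((\<Sum>N<n. real m ^ N * r N) / ?D n - \<alpha>) < e" if n: "n \<ge> max (max M n0) 1" for n
  proof -
    have Dpos: "?D n > 0" using D[of n] n by linarith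
    have "\<bar>\<Sum>N<n. real m ^ N * (r N - \<alpha>)\<bar> \<le> (\<Sum>N<n. \<bar>real m ^ N * (r N - \<alpha>)\<bar>)"
      by (rule sum_abs)
    also have "\<dots> = (\<Sum>N<n. real m ^ N * \<bar>r N - \<alpha>\<bar>)"
      by (simp add: abs_mult)
    also have "\<dots> = K + (\<Sum>N\<in>{M..<n}. real m ^ N * \<bar>r N - \<alpha>\<bar>)"
      using sum.atLeastLessThan_concat[of 0 M n "\<lambda>N. real m ^ N * \<bar>r N - \<alpha>\<bar>"] n
      by (simp add: K_def atLeast0LessThan)
    also have "(\<Sum>N\<in>{M..<n}. real m ^ N * \<bar>r N - \<alpha>\<bar>) \<le> (\<Sum>N\<in>{M..<n}. real m ^ N * (e / 2))"
      using M by (intro sum_mono mult_left_mono) (auto intro: less_imp_le)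
    also have "\<dots> \<le> (\<Sum>N<n. real m ^ N * (e / 2))"
      using e by (intro sum_mono2) auto
    also have "\<dots> = ?D n * (e / 2)" by (simp add: sum_distrib_right)
    also have "K < ?D n * (e / 2)"
    proof -
      have "2 * K / e < ?D n" using n0 n D[of n] by linarith
      then show ?thesis using e by (simp add: field_simps)
    qed
    finally have *: "\<bar>\<Sum>N<n. real m ^ N * (r N - \<alpha>)\<bar> < ?D n * e" by (simp add: field_simps)
    have "(\<Sum>N<n. real m ^ N * \<alpha>) = ?D n * \<alpha>" by (simp add: sum_distrib_right)
    then have "(\<Sum>N<n. real m ^ N * r N) / ?D n - \<alpha> = (\<Sum>N<n. real m ^ N * (r N - \<alpha>)) / ?D n"
      using Dpos by (simp add: right_diff_distrib sum_subtractf diff_divide_distrib)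
    then show ?thesis using * Dpos by (simp add: abs_divide field_simps)
  qed
  then show "\<exists>no. \<forall>n\<ge>no. norm ((\<Sum>N<n. real m ^ N * r N) / ?D n - \<alpha>) < e" by blast
qed

text \<open>
  A form of dominated convergence: for the lower bound only the finitely many terms of one \<open>A M\<close>
  are kept, and their factors tend to 1 simultaneously.
\<close>

lemma truncated_sum_tendsto:
  fixes a :: "'c \<Rightarrow> real" and f :: "'c \<Rightarrow> nat \<Rightarrow> real" and A :: "nat \<Rightarrow> 'c set"
  assumes fin: "\<And>N. finite (A N)" and mono: "\<And>M N. M \<le> N \<Longrightarrow> A M \<subseteq> A N"
    and a: "\<And>c. 0 \<le> a c" and f: "\<And>c N. 0 \<le> f c N \<and> f c N \<le> 1" "\<And>c. f c \<longlonglongrightarrow> 1"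
    and lim: "(\<lambda>N. \<Sum>c\<in>A N. a c) \<longlonglongrightarrow> \<alpha>"
  shows "(\<lambda>N. \<Sum>c\<in>A N. a c * f c N) \<longlonglongrightarrow> \<alpha>"
proof (rule order_tendstoI)
  fix y assume y: "y < \<alpha>"
  then obtain M where M: "y < (\<Sum>c\<in>A M. a c)"
    using order_tendstoD(1)[OF lim y] eventually_happens sequentially_bot by blast
  have "(\<lambda>N. \<Sum>c\<in>A M. a c * f c N) \<longlonglongrightarrow> (\<Sum>c\<in>A M. a c * 1)"
    by (intro tendsto_intros f)
  then have "\<forall>\<^sub>F N in sequentially. y < (\<Sum>c\<in>A M. a c * f c N)"
    using M by (intro order_tendstoD(1)) simp_all
  then show "\<forall>\<^sub>F N in sequentially. y < (\<Sum>c\<in>A N. a c * f c N)"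
    using eventually_ge_at_top[of M]
  proof eventually_elim
    case (elim N)
    have "(\<Sum>c\<in>A M. a c * f c N) \<le> (\<Sum>c\<in>A N. a c * f c N)"
      using fin mono[OF elim(2)] a f(1) by (intro sum_mono2) auto
    then show ?case using elim(1) by linarith
  qed
next
  fix y assume y: "\<alpha> < y"
  have "\<forall>\<^sub>F N in sequentially. (\<Sum>c\<in>A N. a c) < y" by (rule order_tendstoD(2)[OF lim y])
  then show "\<forall>\<^sub>F N in sequentially. (\<Sum>c\<in>A N. a c * f c N) < y"
  proof eventually_elim
    case (elim N)
    have "(\<Sum>c\<in>A N. a c * f c N) \<le> (\<Sum>c\<in>A N. a c)"
      using a f(1) by (intro sum_mono) (simp add: mult_left_le)
    then show ?case using elim by linarith
  qed
qed

section \<open>The dimension of the closures\<close>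

context wreath_product
begin

lemma W_subgroup: "subgroup W (wreath m H)"
  by (rule subgroup_WI) auto

lemma card_actions_W: "card (actions n W) = card H ^ (\<Sum>N<n. m ^ N)"
proof (rule antisym)
  have "card (actions n W) \<le> card H ^ card (\<Union>N<n. level m N)"
  proof (rule card_actions_le)
    show "label g v = id" if "v \<in> tree_words m" "length v < n" "v \<notin> (\<Union>N<n. level m N)" for g v
      using that by (auto simp: level_def)
    show "(\<Union>N<n. level m N) \<subseteq> tree_words m" by (auto simp: level_def)
  qed simp_all
  also have "card (\<Union>N<n. level m N) = (\<Sum>N<n. card (level m N))"
  proof (rule card_UN_disjoint)
    show "\<forall>i\<in>{..<n}. \<forall>j\<in>{..<n}. i \<noteq> j \<longrightarrow> level m i \<inter> level m j = {}"
      by (auto simp: level_def)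
  qed simp_all
  finally show "card (actions n W) \<le> card H ^ (\<Sum>N<n. m ^ N)" by (simp only: card_level)
  have step: "card (actions N W) * card H ^ (m ^ N) \<le> card (actions (Suc N) W)" for N
  proof -
    have "card (actions N W) * card H ^ card (level m N) \<le> card (actions (Suc N) W)"
    proof (rule layer_growth[OF W_subgroup order_refl])
      fix q h assume q: "q \<in> level m N" and h: "h \<in> H"
      have s: "{q} \<subseteq> tree_words m" using q by (auto simp: level_def)
      show "\<exists>z\<in>W. (\<forall>w\<in>level m N. z w = w) \<and> label z q = h \<and> (\<forall>v\<in>level m N - {q}. label z v = id)"
      proof (intro bexI[of _ "mark {q} h"] conjI ballI)
        show "mark {q} h w = w" if "w \<in> level m N" for w
          by (rule mark_fixes_above[OF _ s h])
            (use q that in \<open>auto simp: level_def dest: prefix_length_less\<close>)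
        show "label (mark {q} h) q = h" using label_mark[OF _ s h, of q] s by simp
        show "label (mark {q} h) v = id" if "v \<in> level m N - {q}" for v
          using label_mark[OF _ s h, of v] that by (auto simp: level_def)
        show "mark {q} h \<in> W" by (rule mark_W[OF _ s h]) simp
      qed
    qed
    then show ?thesis by (simp add: card_level)
  qed
  show "card H ^ (\<Sum>N<n. m ^ N) \<le> card (actions n W)"
  proof (induction n)
    case 0
    have "actions 0 W \<noteq> {}" using W_id by blast
    then have "card (actions 0 W) > 0"
      using finite_actions[of W 0] unfolding card_gt_0_iff by blast
    then show ?case unfolding lessThan_0 sum.empty power_0 by linarith
  next
    case (Suc n)
    have "card H ^ (\<Sum>N<Suc n. m ^ N) = card H ^ (\<Sum>N<n. m ^ N) * card H ^ (m ^ n)"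
      by (simp add: power_add)
    also have "\<dots> \<le> card (actions n W) * card H ^ (m ^ n)" by (rule mult_le_mono1[OF Suc.IH])
    also have "\<dots> \<le> card (actions (Suc n) W)" by (rule step)
    finally show ?case .
  qed
qed

lemma hdim_actions:
  assumes "subgroup L (wreath m H)"
  shows "hdim m H L = liminf (\<lambda>n. ereal (ln (real (card (actions n L))) / ln (real (card (actions n W)))))"
  unfolding hdim_def index_eq_card_actions[OF assms] index_eq_card_actions[OF W_subgroup] ..

lemma hdim_bounds:
  assumes L: "subgroup L (wreath m H)"
  shows "hdim m H L \<in> {0..1}"
proof -
  let ?r = "\<lambda>n. ln (real (card (actions n L))) / ln (real (card (actions n W)))"
  have r: "0 \<le> ?r n \<and> ?r n \<le> 1" for n
  proof -
    have LW: "L \<subseteq> W" "L \<noteq> {}" using subgroup_W_D(1,2)[OF L] by auto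
    have "card (actions n L) \<le> card (actions n W)"
      using LW by (intro card_mono finite_actions) auto
    moreover have "card (actions n L) > 0"
      using finite_actions[OF LW(1)] LW(2) by (simp add: card_gt_0_iff)
    ultimately have "0 \<le> ln (real (card (actions n L)))"
      "ln (real (card (actions n L))) \<le> ln (real (card (actions n W)))" by auto
    then show ?thesis by (auto simp: divide_le_eq_1)
  qed
  have "liminf (\<lambda>n. 0) \<le> liminf (\<lambda>n. ereal (?r n))" "liminf (\<lambda>n. ereal (?r n)) \<le> liminf (\<lambda>n. 1)"
    by (intro Liminf_mono always_eventually allI; use r in simp)+
  then show ?thesis by (simp add: hdim_actions[OF L] Liminf_const)
qed

end

context spread
begin

lemma card_H_ge_2: "card H \<ge> 2"
proof -
  obtain h where h: "h \<in> H" "h 1 = 2" using transitive m2 by force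
  then have "{id, h} \<subseteq> H" "id \<noteq> h" by auto
  then show ?thesis using card_mono[OF finite_H, of "{id, h}"] by simp
qed

lemma branchings_at_top: "filterlim (branchings c) at_top sequentially"
proof (rule filterlim_at_top[THEN iffD2], rule allI)
  fix Z :: nat
  have "Z \<le> branchings c N" if "N \<ge> 4 * Z + 16 * to_nat c + 30" for N
  proof -
    have "N div 4 * 4 \<le> N" by simp
    then have "Z * 2 \<le> N - length (address c N) - 1" using that length_addressess_le[of c N] by linarith
    then show ?thesis by (simp add: branchings_def less_eq_div_iff_mult_less_eq)
  qed
  then show "\<forall>\<^sub>F N in sequentially. Z \<le> branchings c N"
    using eventually_at_top_linorder by blast
qed

text \<open>
  The logarithm of the number of actions on level \<open>n\<close>, divided by \<open>ln (card H)\<close>, lies between two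
  sums over the levels \<open>N < n\<close> with terms \<open>m ^ N * r0 N\<close> and \<open>m ^ N * r1 N\<close>. Here \<open>r1 N\<close> is the
  proportion of the vertices on level \<open>N\<close> that lie below \<open>C\<close>, and \<open>r0 N\<close> takes the lost labels into
  account. Both tend to \<open>\<alpha>\<close>.
\<close>

lemma hdim_spread:
  assumes lim: "(\<lambda>N. \<Sum>c\<in>{c \<in> C. length c \<le> N}. (1 / real m) ^ length c) \<longlonglongrightarrow> \<alpha>"
  shows "hdim m H (wreath_closure spread_group) = ereal \<alpha>"
proof -
  let ?C = "\<lambda>N. {c \<in> C. length c \<le> N}"
  let ?e = "\<lambda>c N. 1 - 1 / real m ^ branchings c (N - length c)"
  define r1 where "r1 = (\<lambda>N. \<Sum>c\<in>?C N. (1 / real m) ^ length c)"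
  define r0 where "r0 = (\<lambda>N. \<Sum>c\<in>?C N. (1 / real m) ^ length c * ?e c N)"
  define D where "D n = (\<Sum>N<n. real m ^ N)" for n
  define S where "S r n = (\<Sum>N<n. real m ^ N * r N)" for r :: "nat \<Rightarrow> real" and n
  have m1: "real m > 1" using m2 by simp
  have lnH: "ln (real (card H)) > 0" using card_H_ge_2 by simp
  have pw: "real m ^ (N - k) = real m ^ N * (1 / real m) ^ k" if "k \<le> N" for N k
    using that m1 by (simp add: power_diff power_divide)
  have "r1 \<longlonglongrightarrow> \<alpha>" using lim by (simp add: r1_def)
  moreover have "r0 \<longlonglongrightarrow> \<alpha>"
    unfolding r0_def
  proof (rule truncated_sum_tendsto[OF finite_short _ _ _ _ lim])
    fix c N
    show "0 \<le> ?e c N \<and> ?e c N \<le> 1" using m1 by (simp add: one_le_power)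
    have "filterlim (\<lambda>N. N - length c) at_top sequentially" by (rule filterlim_minus_const_nat_at_top)
    then have "filterlim (\<lambda>N. branchings c (N - length c)) at_top sequentially"
      by (rule filterlim_compose[OF branchings_at_top])
    then have "(\<lambda>N. (1 / real m) ^ branchings c (N - length c)) \<longlonglongrightarrow> 0"
      by (rule filterlim_compose[rotated]) (use m1 in \<open>simp add: LIMSEQ_power_zero\<close>)
    then have "(\<lambda>N. 1 - (1 / real m) ^ branchings c (N - length c)) \<longlonglongrightarrow> 1 - 0"
      by (intro tendsto_intros)
    then show "(\<lambda>N. ?e c N) \<longlonglongrightarrow> 1" by (simp add: power_divide)
  qed (auto simp: m1)
  ultimately have avg: "(\<lambda>n. S r1 n / D n) \<longlonglongrightarrow> \<alpha>" "(\<lambda>n. S r0 n / D n) \<longlonglongrightarrow> \<alpha>"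
    unfolding S_def D_def using geometric_average_tendsto m2 by simp_all
  define I where "I n = card (actions n spread_group)" for n
  have Ipos: "I n > 0" for n
    using finite_actions[OF spread_D(1), of n] spread_D(2) by (auto simp: I_def card_gt_0_iff)
  have upper: "ln (real (I n)) \<le> ln (real (card H)) * S r1 n" for n
  proof -
    let ?E = "\<Sum>N<n. \<Sum>c\<in>?C N. m ^ (N - length c)"
    have "real (I n) \<le> real (card H) ^ ?E"
      using of_nat_mono[OF spread_upper[of n], where ?'a = real] by (simp add: I_def)
    then have "ln (real (I n)) \<le> ln (real (card H) ^ ?E)"
      using Ipos[of n] card_H_ge_2 by (subst ln_le_cancel_iff) auto
    also have "\<dots> = real ?E * ln (real (card H))" using card_H_ge_2 by (simp add: ln_realpow)
    also have "real ?E = S r1 n"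
      by (simp add: S_def r1_def sum_distrib_left pw)
    finally show ?thesis by (simp add: mult.commute)
  qed
  have lower: "ln (real (card H)) * S r0 n \<le> ln (real (I n))" for n
  proof (induction n)
    case 0
    then show ?case using Ipos[of 0] by (simp add: S_def)
  next
    case (Suc n)
    obtain b where b: "I n * card H ^ b \<le> I (Suc n)"
      and bl: "(\<Sum>c\<in>?C n. real m ^ (n - length c) * ?e c n) \<le> real b"
      using spread_layer[of n] by (auto simp: I_def)
    have "real m ^ n * r0 n = (\<Sum>c\<in>?C n. real m ^ (n - length c) * ?e c n)"
      by (simp add: r0_def sum_distrib_left pw mult.assoc)
    then have "ln (real (card H)) * (real m ^ n * r0 n) \<le> ln (real (card H)) * real b"
      using bl lnH by simp
    then have "ln (real (card H)) * S r0 (Suc n) \<le> ln (real (I n)) + real b * ln (real (card H))"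
      using Suc by (simp add: S_def distrib_left mult.commute)
    also have "\<dots> = ln (real (I n) * real (card H) ^ b)"
      using Ipos[of n] card_H_ge_2 by (simp add: ln_mult ln_realpow)
    also have "\<dots> \<le> ln (real (I (Suc n)))"
      using of_nat_mono[OF b, where ?'a = real] Ipos[of n] Ipos[of "Suc n"] card_H_ge_2
      by (subst ln_le_cancel_iff) auto
    finally show ?case .
  qed
  have J: "ln (real (card (actions n W))) = ln (real (card H)) * D n" for n
    using card_H_ge_2 by (simp add: card_actions_W ln_realpow D_def mult.commute)
  have Dnn: "D n \<ge> 0" for n by (simp add: D_def sum_nonneg)
  have "(\<lambda>n. ln (real (I n)) / ln (real (card (actions n W)))) \<longlonglongrightarrow> \<alpha>"
  proof (rule tendsto_sandwich[OF always_eventually always_eventually avg(2,1)]; rule allI)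
    fix n
    have eq: "S r n / D n = ln (real (card H)) * S r n / (ln (real (card H)) * D n)" for r
      using lnH by simp
    have nn: "0 \<le> ln (real (card H)) * D n" using lnH Dnn by simp
    show "S r0 n / D n \<le> ln (real (I n)) / ln (real (card (actions n W)))"
      unfolding J eq by (rule divide_right_mono[OF lower nn])
    show "ln (real (I n)) / ln (real (card (actions n W))) \<le> S r1 n / D n"
      unfolding J eq by (rule divide_right_mono[OF upper nn])
  qed
  then have "liminf (\<lambda>n. ereal (ln (real (I n)) / ln (real (card (actions n W))))) = ereal \<alpha>"
    by (intro lim_imp_Liminf) (simp_all add: tendsto_ereal)
  moreover have "subgroup (wreath_closure spread_group) (wreath m H)"
    using closed_subgroup_closure[OF spread_subgroup] by (simp add: closed_subgroup_def)
  ultimately show ?thesis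
    by (simp add: hdim_actions closure_actions[OF spread_D(1)] I_def)
qed

lemma spread_in_hspec_gen: "hdim m H (wreath_closure spread_group) \<in> hspec_gen (4 * card H) m H"
proof -
  have "spread_group \<subseteq> wreath_closure spread_group"
    using closure_of_subset spread_D(1) topspace_wreath_topology by metis
  then have "top_generates m H spread_gens (wreath_closure spread_group)"
    using spread_gens_subset by (auto simp: top_generates_def spread_group_def)
  then show ?thesis
    unfolding hspec_gen_def
    using closed_subgroup_closure[OF spread_subgroup] spread_gens_finite by blast
qed

end

section \<open>Prefix-free sets of prescribed measure\<close>

text \<open>
  The scaled remainder in the greedy expansion of \<open>\<alpha>\<close>. Capping the digit at \<open>m - 1\<close> matters only
  for \<open>\<alpha> = 1\<close>, whose remainders are all 1 and whose digits are all \<open>m - 1\<close>.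
\<close>

primrec remainder :: "nat \<Rightarrow> real \<Rightarrow> nat \<Rightarrow> real"
  where "remainder m \<alpha> 0 = \<alpha>"
  | "remainder m \<alpha> (Suc i) = real m * remainder m \<alpha> i -
      min (real m - 1) (of_int \<lfloor>real m * remainder m \<alpha> i\<rfloor>)"

lemma digit_expansion:
  assumes m: "m \<ge> 2" and \<alpha>: "0 \<le> \<alpha>" "\<alpha> \<le> 1"
  shows "\<exists>a :: nat \<Rightarrow> nat. (\<forall>i. a i < m) \<and> (\<lambda>N. \<Sum>i<N. real (a i) * (1 / real m) ^ Suc i) \<longlonglongrightarrow> \<alpha>"
proof -
  let ?x = "remainder m \<alpha>"
  have x: "0 \<le> ?x i \<and> ?x i \<le> 1" for i
  proof (induction i)
    case (Suc i)
    have "real m * ?x i \<le> real m" using Suc m by (simp add: mult_left_le)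
    then show ?case
      by (cases "real m - 1 \<le> of_int \<lfloor>real m * ?x i\<rfloor>") (simp_all add: min_def, linarith+)
  qed (use \<alpha> in simp)
  define a where "a i = nat (min (int m - 1) \<lfloor>real m * ?x i\<rfloor>)" for i
  have a_nn: "0 \<le> min (int m - 1) \<lfloor>real m * ?x i\<rfloor>" for i
    using x[of i] m by simp
  have a: "real (a i) = min (real m - 1) (of_int \<lfloor>real m * ?x i\<rfloor>)" for i
    using a_nn[of i] by (simp add: a_def of_nat_nat of_int_min del: min_le_iff_disj)
  have am: "a i < m" for i
    unfolding a_def using m min.cobounded1[of "int m - 1" "\<lfloor>real m * ?x i\<rfloor>"] by linarith
  have "(\<Sum>i<N. real (a i) * (1 / real m) ^ Suc i) = \<alpha> - ?x N * (1 / real m) ^ N" for N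
  proof (induction N)
    case (Suc N)
    have "?x (Suc N) = real m * ?x N - real (a N)" by (simp add: a)
    then have "?x (Suc N) * (1 / real m) ^ Suc N = ?x N * (1 / real m) ^ N - real (a N) * (1 / real m) ^ Suc N"
      using m by (simp add: field_simps)
    then show ?case using Suc by simp
  qed simp
  moreover have "(\<lambda>N. \<alpha> - ?x N * (1 / real m) ^ N) \<longlonglongrightarrow> \<alpha> - 0"
  proof (intro tendsto_intros)
    show "(\<lambda>N. ?x N * (1 / real m) ^ N) \<longlonglongrightarrow> 0"
    proof (rule tendsto_sandwich[of "\<lambda>_. 0" _ _ "\<lambda>N. (1 / real m) ^ N"])
      show "(\<lambda>N. (1 / real m) ^ N) \<longlonglongrightarrow> 0" by (rule LIMSEQ_power_zero) (use m in simp)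
    qed (use x in \<open>auto intro!: always_eventually mult_left_le_one_le\<close>)
  qed
  ultimately show ?thesis using am by (intro exI[of _ a]) simp
qed

text \<open>
  The spine consists of the words \<open>m\<^sup>i\<close>. As the digits are less than \<open>m\<close>, the words that leave it
  through a letter \<open>x \<le> a i\<close> are prefix-free.
\<close>

definition digit_words :: "nat \<Rightarrow> (nat \<Rightarrow> nat) \<Rightarrow> nat list set"
  where "digit_words m a = {replicate i m @ [x] | i x. 1 \<le> x \<and> x \<le> a i}"

lemma prefix_free_digit_words:
  assumes "\<And>i. a i < m"
  shows "prefix_free (digit_words m a)"
proof -
  have "replicate i m @ [x] = replicate j m @ [y]"
    if p: "prefix (replicate i m @ [x]) (replicate j m @ [y])" and x: "x \<le> a i" for i j x y
  proof -
    have "i = j"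
    proof (rule ccontr)
      assume "i \<noteq> j"
      moreover have "i \<le> j" using prefix_length_le[OF p] by simp
      ultimately have "i < j" by simp
      then have "m = x" using nth_prefix[OF p, of i] by (simp add: nth_append)
      then show False using x assms[of i] by simp
    qed
    then show ?thesis using p by simp
  qed
  then show ?thesis unfolding prefix_free_def digit_words_def by blast
qed

lemma sum_digit_words:
  "(\<Sum>c\<in>{c \<in> digit_words m a. length c \<le> N}. (1 / real m) ^ length c) =
    (\<Sum>i<N. real (a i) * (1 / real m) ^ Suc i)"
proof -
  let ?f = "\<lambda>(i, x). replicate i m @ [x]"
  have "{c \<in> digit_words m a. length c \<le> N} = ?f ` (SIGMA i:{..<N}. {1..a i})"
    by (auto simp: digit_words_def image_iff Bex_def)
  moreover have "inj_on ?f (SIGMA i:{..<N}. {1..a i})"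
    by (auto simp: inj_on_def)
  ultimately have "(\<Sum>c\<in>{c \<in> digit_words m a. length c \<le> N}. (1 / real m) ^ length c) =
    (\<Sum>(i, x)\<in>(SIGMA i:{..<N}. {1..a i}). (1 / real m) ^ Suc i)"
    by (simp add: sum.reindex case_prod_unfold)
  also have "\<dots> = (\<Sum>i<N. \<Sum>x\<in>{1..a i}. (1 / real m) ^ Suc i)"
    by (rule sum.Sigma[symmetric]) auto
  finally show ?thesis by simp
qed

theorem theorem4:
  fixes m :: nat and H :: "(nat \<Rightarrow> nat) set"
  assumes "m \<ge> 2"
    and "subgroup H (sym_group m)"
    and "\<forall>x\<in>{1..m}. \<forall>y\<in>{1..m}. \<exists>h\<in>H. h x = y"
  shows "\<exists>b\<ge>2. hspec_gen b m H = hspec_fg m H \<and> hspec_fg m H = hspec m H \<and>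
    hspec m H = {0..1::ereal}"
proof -
  interpret transitive_wreath_product m H
    by (intro transitive_wreath_product.intro wreath_product.intro
      transitive_wreath_product_axioms.intro assms)
  let ?b = "4 * card H"
  have "H \<noteq> {}" using H_id by blast
  then have "card H > 0" using finite_H by (simp add: card_gt_0_iff)
  then have b: "?b \<ge> 2" by simp
  have "hspec_gen ?b m H \<subseteq> hspec_fg m H" "hspec_fg m H \<subseteq> hspec m H"
    by (auto simp: hspec_gen_def hspec_fg_def hspec_def)
  moreover have "hspec m H \<subseteq> {0..1}"
    using hdim_bounds by (auto simp: hspec_def closed_subgroup_def)
  moreover have "{0..1} \<subseteq> hspec_gen ?b m H"
  proof
    fix \<beta> :: ereal assume "\<beta> \<in> {0..1}"
    then obtain \<alpha> where \<alpha>: "\<beta> = ereal \<alpha>" "0 \<le> \<alpha>" "\<alpha> \<le> 1"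
      by (cases \<beta>) (auto simp: one_ereal_def zero_ereal_def)
    obtain a :: "nat \<Rightarrow> nat" where a: "\<And>i. a i < m"
      "(\<lambda>N. \<Sum>i<N. real (a i) * (1 / real m) ^ Suc i) \<longlonglongrightarrow> \<alpha>"
      using digit_expansion[OF assms(1) \<alpha>(2,3)] by blast
    interpret spread m H "digit_words m a"
    proof (intro spread.intro transitive_wreath_product_axioms spread_axioms.intro)
      show "prefix_free (digit_words m a)" by (rule prefix_free_digit_words[OF a(1)])
      show "digit_words m a \<subseteq> tree_words m"
        using assms(1) less_imp_le[OF le_less_trans[OF _ a(1)]]
        by (auto simp: digit_words_def tree_words_def)
    qed
    show "\<beta> \<in> hspec_gen ?b m H"
      using hdim_spread[of \<alpha>] spread_in_hspec_gen a(2) \<alpha>(1) by (simp add: sum_digit_words)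
  qed
  ultimately show ?thesis using b by (intro exI[of _ ?b]) auto
qed

end
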